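(* Let $p>3$ be a prime. Then $$\sum_{k=0}^{p-1}\frac{\binom{2k}k\binom{3k}k}{27^k(3k+2)}\equiv\frac1{2\binom{2(p-1)/3}{(p-1)/3}}\pmod{p^2}\ \text{ if } p\equiv1\pmod3,$$ $$\sum_{k=0}^{p-1}\frac{\binom{2k}k\binom{3k}k}{27^k(3k+1)}\equiv\frac{1+2p}{2\binom{2(p-2)/3}{(p-2)/3}}\pmod{p^2}\ \text{ if } p\equiv2\pmod3,$$ $$\sum_{k=0}^{p-1}\frac{\binom{2k}k\binom{4k}{2k}}{64^k(4k+3)}\equiv(-1)^{\frac{p-1}4}\frac{2^{p-1}+1}{6\binom{(p-1)/2}{(p-1)/4}}\pmod{p^2}\ \text{ if } p\equiv1\pmod4,$$ $$\sum_{k=0}^{p-1}\frac{\binom{2k}k\binom{4k}{2k}}{64^k(4k+1)}\equiv(-1)^{\frac{p+1}4}\frac{2^{p-1}+2p+1}{6\binom{(p-3)/2}{(p-3)/4}}\pmod{p^2}\ \text{ if } p\equiv3\pmod4,$$ $$\sum_{k=0}^{p-1}\frac{\binom{3k}k\binom{6k}{3k}}{432^k(6k+5)}\equiv\frac{1-\frac43(2^{p-1}-1)}{5\binom{5(p-1)/6}{(p-1)/6}}\pmod{p^2}\ \text{ if } p\equiv1\pmod6,$$ $$\sum_{k=0}^{p-1}\frac{\binom{3k}k\binom{6k}{3k}}{432^k(6k+1)}\equiv\frac45\cdot\frac{1+5p-\frac43(2^{p-1}-1)}{\binom{(5p-7)/6}{(p-5)/6}}\pmod{p^2}\ \text{ if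 } p\equiv5\pmod6.$$
   Context: Congruences are taken in the ring $\mathbb Z_p$ of rational numbers whose denominators are not divisible by $p$.
   Formalization: The sixth congruence (p ≡ 5 mod 6) is stated for p ≠ 5: at p = 5 the sum and the right side 24/5 both have denominators divisible by 5, so they are not in Z_p, and their difference is not divisible by 25. *)

theory Defs
  imports "HOL-Number_Theory.Number_Theory"
begin

(* The second component of quotient_of is the positive denominator in lowest terms. *)
definition Z_loc :: "nat \<Rightarrow> rat set" where
  "Z_loc p = {x. \<not> int p dvd snd (quotient_of x)}"

(* Congruence modulo the ideal (m) of the ring Z_loc p.  Both sides have to lie in the ring. *)
definition cong_loc :: "nat \<Rightarrow> rat \<Rightarrow> rat \<Rightarrow> rat \<Rightarrow> bool" where
  "cong_loc p x y m \<longleftrightarrow> x \<in> Z_loc p \<and> y \<in> Z_loc p \<and> (\<exists>c \<in> Z_loc p. x - y = m * c)"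

end

theory Submission
  imports Defs
begin

text \<open>
  All six sums have the form \<open>F a = (\<Sum>k<p. (a gchoose k) * ((- 1 - a) gchoose k) / (k + b))\<close> up to a constant
  factor, where \<open>b = 1 + a\<close> and \<open>a = - (r / m) = n + p * t\<close> with \<open>t = - (1 / m)\<close>, \<open>p = m * n + r\<close> and
  \<open>m = 3, 4, 6\<close>. For fixed \<open>b\<close> one has \<open>(x + b + 1) * F (x + 1) = (x + 1 - b) * F x\<close> up to an explicit error
  term, which is divisible by \<open>p\<^sup>2\<close> for \<open>x = p * t + j\<close> with \<open>j < p - 1\<close>. This reduces \<open>F a\<close> to \<open>F (p * t)\<close>,
  whose summands are divisible by \<open>p\<close> except for \<open>k = 0\<close> and for \<open>k = p - 1 - n\<close>, where \<open>k + b\<close> is a multiple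
  of \<open>p\<close>. The outcome is
  \<open>(1 + 2 * t) / (1 + t) * (- 1) ^ n * n! / (\<Prod>i = n + 1..2 * n + 1. i + 2 * p * t)\<close> modulo \<open>p\<^sup>2\<close>. Expanding
  this product to first order in \<open>p\<close> brings in a difference of harmonic numbers, which vanishes modulo \<open>p\<close>
  by the reflection \<open>i \<mapsto> p - i\<close> if \<open>m = 3\<close> and is twice the Fermat quotient of 2 if \<open>m = 6\<close>.
\<close>

section \<open>Congruences in the localization at a prime\<close>

text \<open>The denominator in lowest terms divides every other denominator of the same number. So
  any representation as a fraction can serve as evidence, and the closure properties need no
  reduction of fractions.\<close>

lemma Z_loc_iff: "x \<in> Z_loc p \<longleftrightarrow> (\<exists>a b. x = of_int a / of_int b \<and> \<not> int p dvd b)"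
proof
  assume "x \<in> Z_loc p"
  then have "\<not> int p dvd snd (quotient_of x)" by (simp add: Z_loc_def)
  moreover have "x = of_int (fst (quotient_of x)) / of_int (snd (quotient_of x))"
    by (rule quotient_of_div) simp
  ultimately show "\<exists>a b. x = of_int a / of_int b \<and> \<not> int p dvd b" by blast
next
  assume "\<exists>a b. x = of_int a / of_int b \<and> \<not> int p dvd b"
  then obtain a b where x: "x = of_int a / of_int b" and b: "\<not> int p dvd b" by blast
  obtain n d where nd: "quotient_of x = (n, d)" by fastforce
  have d: "d > 0" "coprime n d" "x = of_int n / of_int d"
    using nd quotient_of_denom_pos quotient_of_coprime quotient_of_div by blast+
  have "b \<noteq> 0" using b by auto
  then have "(of_int (n * b) :: rat) = of_int (a * d)"
    using d x by (simp add: field_simps)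
  then have "n * b = a * d" by (simp only: of_int_eq_iff)
  then have "d dvd n * b" by simp
  then have "d dvd b" using d(2) by (metis coprime_commute coprime_dvd_mult_right_iff)
  then have "\<not> int p dvd d" using b dvd_trans by blast
  then show "x \<in> Z_loc p" by (simp add: Z_loc_def nd)
qed

section \<open>The ring of p-integral rationals and its units\<close>

locale prime_localization =
  fixes p :: nat
  assumes prime_p: "prime p"
begin

abbreviation R :: "rat set" where "R \<equiv> Z_loc p"

abbreviation P :: rat where "P \<equiv> of_nat p"

definition cg :: "nat \<Rightarrow> rat \<Rightarrow> rat \<Rightarrow> bool" where
  "cg e x y \<longleftrightarrow> cong_loc p x y (P ^ e)"

text \<open>Neither \<open>x \<in> R\<close> nor \<open>x \<noteq> 0\<close> is implied: since
  \<open>inverse 0 = 0\<close>, zero satisfies \<open>unit\<close>. Lemmas that cancel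
  \<open>x\<close> therefore carry \<open>x \<noteq> 0\<close> as a separate hypothesis.\<close>

abbreviation unit :: "rat \<Rightarrow> bool" where "unit x \<equiv> inverse x \<in> R"

lemma prime_int_p: "prime (int p)" using prime_p by simp

lemma p_nonzero [simp]: "p \<noteq> 0" using prime_p by auto

named_theorems R_intros

lemma R_of_int [R_intros]: "of_int a \<in> R"
proof -
  have "of_int a = (of_int a / of_int 1 :: rat)" "\<not> int p dvd 1" using prime_p by auto
  then show ?thesis unfolding Z_loc_iff by blast
qed

lemma R_of_nat [R_intros]: "of_nat a \<in> R" using R_of_int[of "int a"] by simp

lemma R_numeral [R_intros]: "numeral a \<in> R" "0 \<in> R" "1 \<in> R"
  using R_of_nat[of "numeral a"] R_of_nat[of 0] R_of_nat[of 1] by simp_all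

lemma R_add [R_intros]: assumes "x \<in> R" "y \<in> R" shows "x + y \<in> R"
proof -
  obtain a b c d where *: "x = of_int a / of_int b" "\<not> int p dvd b"
      "y = of_int c / of_int d" "\<not> int p dvd d" using assms unfolding Z_loc_iff by blast
  have "b \<noteq> 0" "d \<noteq> 0" using * by auto
  then have "x + y = of_int (a * d + c * b) / of_int (b * d)" using * by (simp add: field_simps)
  moreover have "\<not> int p dvd b * d" using * prime_int_p by (simp add: prime_dvd_mult_iff)
  ultimately show ?thesis unfolding Z_loc_iff by blast
qed

lemma R_mult [R_intros]: assumes "x \<in> R" "y \<in> R" shows "x * y \<in> R"
proof -
  obtain a b c d where *: "x = of_int a / of_int b" "\<not> int p dvd b"
      "y = of_int c / of_int d" "\<not> int p dvd d" using assms unfolding Z_loc_iff by blast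
  then have "x * y = of_int (a * c) / of_int (b * d)" by simp
  moreover have "\<not> int p dvd b * d" using * prime_int_p by (simp add: prime_dvd_mult_iff)
  ultimately show ?thesis unfolding Z_loc_iff by blast
qed

lemma R_uminus [R_intros]: "x \<in> R \<Longrightarrow> - x \<in> R"
  using R_mult[OF R_of_int[of "-1"]] by fastforce

lemma R_diff [R_intros]: "x \<in> R \<Longrightarrow> y \<in> R \<Longrightarrow> x - y \<in> R"
  using R_add[OF _ R_uminus] by fastforce

lemma R_power [R_intros]: "x \<in> R \<Longrightarrow> x ^ k \<in> R"
  by (induction k) (auto intro: R_intros)

lemma R_sum [R_intros]: "(\<And>i. i \<in> A \<Longrightarrow> f i \<in> R) \<Longrightarrow> sum f A \<in> R"
  by (induction A rule: infinite_finite_induct) (auto intro: R_intros)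

lemma R_prod [R_intros]: "(\<And>i. i \<in> A \<Longrightarrow> f i \<in> R) \<Longrightarrow> prod f A \<in> R"
  by (induction A rule: infinite_finite_induct) (auto intro: R_intros)

lemma R_fact [R_intros]: "fact k \<in> R"
  by (metis R_of_nat of_nat_fact)

lemma R_divide [R_intros]: "x \<in> R \<Longrightarrow> unit y \<Longrightarrow> x / y \<in> R"
  by (simp add: divide_inverse R_mult)

lemma unit_of_nat: assumes "\<not> p dvd i" shows "unit (of_nat i)"
proof -
  have "inverse (of_nat i) = (of_int 1 / of_int (int i) :: rat)" by (simp add: divide_inverse)
  moreover have "\<not> int p dvd int i" using assms by simp
  ultimately show ?thesis unfolding Z_loc_iff by blast
qed

lemma unit_less: "0 < i \<Longrightarrow> i < p \<Longrightarrow> unit (of_nat i)"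
  by (rule unit_of_nat) (simp add: nat_dvd_not_less)

lemma unit_prod: "(\<And>i. i \<in> A \<Longrightarrow> unit (f i)) \<Longrightarrow> unit (prod f A)"
  by (induction A rule: infinite_finite_induct) (auto intro: R_intros)

lemma unit_fact: "i < p \<Longrightarrow> unit (fact i)"
  using prime_p unit_of_nat[of "fact i"] by (auto simp: prime_dvd_fact_iff)

lemma P_not_unit: "inverse P \<notin> R"
proof
  assume "inverse P \<in> R"
  then obtain a b where ab: "inverse P = of_int a / of_int b" "\<not> int p dvd b"
    unfolding Z_loc_iff by blast
  then have "b \<noteq> 0" by auto
  then have "of_int b = (of_int (a * int p) :: rat)" using ab(1) by (simp add: field_simps)
  then have "b = a * int p" by (simp only: of_int_eq_iff)
  then show False using ab(2) by simp
qed

text \<open>If \<open>p\<close> divided the numerator of \<open>x + P * c\<close>, then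
  \<open>x\<close> would be \<open>P\<close> times a ring element, and dividing by the unit
  \<open>x\<close> would put \<open>inverse P\<close> into the ring, against
  \<open>P_not_unit\<close>.\<close>

lemma unit_add_multiple:
  assumes "x \<in> R" "unit x" "c \<in> R" "x \<noteq> 0"
  shows "unit (x + P * c)" "x + P * c \<noteq> 0"
proof -
  have "x + P * c \<in> R" using assms by (intro R_intros)
  then obtain a b where ab: "x + P * c = of_int a / of_int b" "\<not> int p dvd b"
    unfolding Z_loc_iff by blast
  have "\<not> int p dvd a"
  proof
    assume "int p dvd a"
    then obtain k where k: "a = int p * k" by blast
    have "of_int k / of_int b - c \<in> R" using ab(2) Z_loc_iff assms(3) by (blast intro: R_diff)
    then have "inverse x * (of_int k / of_int b - c) \<in> R" using assms(2) by (rule R_mult[rotated])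
    moreover have "x = P * (of_int k / of_int b - c)"
      using ab(1) k by (simp add: algebra_simps)
    then have "inverse x * (of_int k / of_int b - c) = inverse P" using assms(4)
      by (simp add: field_simps)
    ultimately show False using P_not_unit by simp
  qed
  moreover have "inverse (x + P * c) = of_int b / of_int a" using ab(1) by simp
  ultimately show "unit (x + P * c)" unfolding Z_loc_iff by blast
  have "a \<noteq> 0" "b \<noteq> 0" using \<open>\<not> int p dvd a\<close> ab(2) by auto
  then show "x + P * c \<noteq> 0" using ab(1) by simp
qed

section \<open>Calculus of congruences modulo powers of \<open>p\<close>\<close>

lemma cg_refl: "x \<in> R \<Longrightarrow> cg e x x"
  unfolding cg_def cong_loc_def using R_numeral(2) by force

lemma cgI: "x \<in> R \<Longrightarrow> y \<in> R \<Longrightarrow> c \<in> R \<Longrightarrow> x - y = P ^ e * c \<Longrightarrow> cg e x y"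
  unfolding cg_def cong_loc_def by blast

lemma cgI':
  assumes "y \<in> R" "c \<in> R" "x = y + P ^ e * c" shows "cg e x y"
  using assms by (intro cgI[of _ _ c]) (auto intro!: R_intros)

lemma cgE:
  assumes "cg e x y"
  obtains c where "c \<in> R" "x = y + P ^ e * c" "x \<in> R" "y \<in> R"
  using assms unfolding cg_def cong_loc_def by (metis add_diff_cancel_left' add.commute diff_add_cancel)

lemma cg_sym: assumes "cg e x y" shows "cg e y x"
proof -
  obtain c where "c \<in> R" "x = y + P ^ e * c" "x \<in> R" "y \<in> R" using assms by (rule cgE)
  then show ?thesis by (intro cgI[of _ _ "-c"]) (auto intro: R_intros)
qed

lemma cg_add: assumes "cg e x y" "cg e u v" shows "cg e (x + u) (y + v)"
proof -
  obtain c where c: "c \<in> R" "x = y + P ^ e * c" "x \<in> R" "y \<in> R" using assms(1) by (rule cgE)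
  obtain d where d: "d \<in> R" "u = v + P ^ e * d" "u \<in> R" "v \<in> R" using assms(2) by (rule cgE)
  show ?thesis using c d by (intro cgI'[of _ "c + d"]) (auto intro: R_intros simp: algebra_simps)
qed

lemma cg_mult: assumes "cg e x y" "cg e u v" shows "cg e (x * u) (y * v)"
proof -
  obtain c where c: "c \<in> R" "x = y + P ^ e * c" "x \<in> R" "y \<in> R" using assms(1) by (rule cgE)
  obtain d where d: "d \<in> R" "u = v + P ^ e * d" "u \<in> R" "v \<in> R" using assms(2) by (rule cgE)
  show ?thesis using c d
    by (intro cgI'[of _ "c * u + y * d"]) (auto intro!: R_intros simp: algebra_simps)
qed

lemma cg_trans [trans]: assumes "cg e x y" "cg e y z" shows "cg e x z"
proof -
  obtain c where c: "c \<in> R" "x = y + P ^ e * c" "x \<in> R" "y \<in> R" using assms(1) by (rule cgE)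
  obtain d where d: "d \<in> R" "y = z + P ^ e * d" "y \<in> R" "z \<in> R" using assms(2) by (rule cgE)
  show ?thesis using c d
    by (intro cgI'[of _ "c + d"]) (auto intro!: R_intros simp: algebra_simps)
qed

lemma cg_uminus: "cg e x y \<Longrightarrow> cg e (- x) (- y)"
  using cg_mult[OF cg_refl[of "-1"]] R_uminus[OF R_numeral(3)] by fastforce

lemma cg_diff: "cg e x y \<Longrightarrow> cg e u v \<Longrightarrow> cg e (x - u) (y - v)"
  using cg_add[OF _ cg_uminus] by fastforce

lemma cg_sum: "(\<And>i. i \<in> A \<Longrightarrow> cg e (f i) (g i)) \<Longrightarrow> cg e (sum f A) (sum g A)"
  by (induction A rule: infinite_finite_induct) (auto intro: cg_add cg_refl R_intros)

lemma cg_prod: "(\<And>i. i \<in> A \<Longrightarrow> cg e (f i) (g i)) \<Longrightarrow> cg e (prod f A) (prod g A)"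
  by (induction A rule: infinite_finite_induct) (auto intro: cg_mult cg_refl R_intros)

lemma cg_inverse:
  assumes "cg e x y" "unit x" "unit y" "x \<noteq> 0" "y \<noteq> 0"
  shows "cg e (inverse x) (inverse y)"
proof -
  obtain c where c: "c \<in> R" "x = y + P ^ e * c" "x \<in> R" "y \<in> R" using assms(1) by (rule cgE)
  have "inverse x - inverse y = inverse x * inverse y * (y - x)"
    using assms by (simp add: field_simps)
  also have "\<dots> = P ^ e * (- (inverse x * inverse y * c))"
    using c(2) by (simp add: algebra_simps)
  finally show ?thesis using assms c by (intro cgI[of _ _ "- (inverse x * inverse y * c)"] R_intros)
qed

text \<open>A factor \<open>P\<close> raises the precision by one. Hence terms that carry such a
  factor need to be known only modulo \<open>p\<close>.\<close>

lemma cg_P_mult: assumes "cg e x y" shows "cg (Suc e) (P * x) (P * y)"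
proof -
  obtain c where c: "c \<in> R" "x = y + P ^ e * c" "x \<in> R" "y \<in> R" using assms(1) by (rule cgE)
  then show ?thesis by (intro cgI'[of _ c]) (auto intro!: R_intros simp: algebra_simps)
qed

lemma cg_P_mult_1: "cg 1 x y \<Longrightarrow> cg 2 (P * x) (P * y)"
  using cg_P_mult[of 1] by (simp add: numeral_2_eq_2)

lemma cg_mult_left: "a \<in> R \<Longrightarrow> cg e x y \<Longrightarrow> cg e (a * x) (a * y)"
  by (rule cg_mult[OF cg_refl])

text \<open>Truncated geometric series of \<open>1 / (x + P * c)\<close>; the remainder after the
  linear term is exactly \<open>P^2 * c^2 / (x^2 * (x + P * c))\<close>.\<close>

lemma cg_inverse_shift:
  assumes "x \<in> R" "unit x" "c \<in> R" "x \<noteq> 0"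
  shows "cg 1 (inverse (x + P * c)) (inverse x)"
    and "cg 2 (inverse (x + P * c)) (inverse x - P * c * (inverse x)\<^sup>2)"
proof -
  note u = unit_add_multiple[OF assms]
  have "cg 1 (x + P * c) x" using assms by (intro cgI'[of _ c]) auto
  then show "cg 1 (inverse (x + P * c)) (inverse x)"
    using u assms by (intro cg_inverse)
  have "inverse (x + P * c) = (inverse x - P * c * (inverse x)\<^sup>2)
      + P ^ 2 * (c\<^sup>2 * (inverse x)\<^sup>2 * inverse (x + P * c))"
  proof -
    have "w = u - y * c * u\<^sup>2 + y\<^sup>2 * (c\<^sup>2 * u\<^sup>2 * w)" if "x * u = 1" "(x + y * c) * w = 1" for u w y
      using that by Groebner_Basis.algebra
    then show ?thesis using u(2) assms(4) by simp
  qed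
  then show "cg 2 (inverse (x + P * c)) (inverse x - P * c * (inverse x)\<^sup>2)"
    using assms u by (intro cgI'[of _ "c\<^sup>2 * (inverse x)\<^sup>2 * inverse (x + P * c)"] R_intros)
qed

text \<open>First-order expansion of the product in \<open>P * s\<close>: the logarithmic derivative
  contributes the sum of reciprocals, and every term using \<open>P * s\<close> twice vanishes
  modulo \<open>p^2\<close>.\<close>

lemma prod_shift:
  assumes "finite A" "\<And>i. i \<in> A \<Longrightarrow> \<not> p dvd i" "s \<in> R"
  shows "cg 2 (\<Prod>i\<in>A. of_nat i + P * s)
              ((\<Prod>i\<in>A. of_nat i) * (1 + P * s * (\<Sum>i\<in>A. inverse (of_nat i))))"
  using assms
proof (induction A rule: finite_induct)
  case empty
  then show ?case by (auto intro!: cg_refl R_intros)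
next
  case (insert j A)
  let ?\<Pi> = "\<Prod>i\<in>A. (of_nat i :: rat)" and ?\<Sigma> = "\<Sum>i\<in>A. inverse (of_nat i :: rat)"
  have R: "?\<Sigma> \<in> R" "?\<Pi> \<in> R" "unit (of_nat j)"
    using insert by (auto intro!: R_intros unit_of_nat)
  have "j \<noteq> 0" using insert by (metis dvd_0_right insertI1)
  have "cg 2 ((of_nat j + P * s) * (\<Prod>i\<in>A. of_nat i + P * s))
         ((of_nat j + P * s) * (?\<Pi> * (1 + P * s * ?\<Sigma>)))"
    using insert by (intro cg_mult_left) (auto intro!: R_intros)
  also have "cg 2 \<dots> (of_nat j * ?\<Pi> * (1 + P * s * (inverse (of_nat j) + ?\<Sigma>)))"
  proof (rule cgI'[of _ "s ^ 2 * ?\<Pi> * ?\<Sigma>"])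
    have "(k + y * s) * (a * (1 + y * s * b)) = k * a * (1 + y * s * (u + b)) + y\<^sup>2 * (s\<^sup>2 * a * b)"
      if "k * u = 1" for k u a b y :: rat using that by Groebner_Basis.algebra
    then show "(of_nat j + P * s) * (?\<Pi> * (1 + P * s * ?\<Sigma>)) =
        of_nat j * ?\<Pi> * (1 + P * s * (inverse (of_nat j) + ?\<Sigma>)) + P ^ 2 * (s ^ 2 * ?\<Pi> * ?\<Sigma>)"
      using \<open>j \<noteq> 0\<close> by simp
    show "s ^ 2 * ?\<Pi> * ?\<Sigma> \<in> R"
      using R(1,2) insert.prems(2) by (intro R_mult R_power)
    show "of_nat j * ?\<Pi> * (1 + P * s * (inverse (of_nat j) + ?\<Sigma>)) \<in> R"
      using R insert.prems(2) by (intro R_mult R_add R_of_nat R_numeral)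
  qed
  finally show ?case using insert by simp
qed

section \<open>Harmonic numbers modulo \<open>p\<close>\<close>

abbreviation H :: "nat \<Rightarrow> rat" where "H n \<equiv> \<Sum>i=1..n. inverse (of_nat i)"

lemma R_H: "n < p \<Longrightarrow> H n \<in> R"
  by (intro R_sum unit_less) auto

lemma inverse_reflect: 
  assumes "0 < k" "k < p" shows "cg 1 (inverse (of_nat (p - k))) (- inverse (of_nat k))"
proof -
  have "cg 1 (inverse (- of_nat k + P * 1)) (inverse (- of_nat k))"
    using assms unit_less[of k] by (intro cg_inverse_shift(1)) (auto intro!: R_intros)
  then show ?thesis using assms by (simp add: of_nat_diff)
qed

text \<open>Reversing the sum by \<open>i\<close> to \<open>p - i\<close> changes the sign of every
  term modulo \<open>p\<close>, so \<open>H (p - 1)\<close> is congruent to its negative, and 2 is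
  invertible.\<close>

lemma H_top: assumes "p > 2" shows "cg 1 (H (p - 1)) 0"
proof -
  have "H (p - 1) = (\<Sum>i=1..p-1. inverse (of_nat (p - i)))"
    by (rule sum.reindex_bij_witness[of _ "\<lambda>i. p - i" "\<lambda>i. p - i"]) auto
  also have "cg 1 \<dots> (\<Sum>i=1..p-1. - inverse (of_nat i))"
    by (intro cg_sum inverse_reflect) auto
  finally have "cg 1 (H (p - 1)) (- H (p - 1))" by (simp add: sum_negf)
  moreover have HR: "H (p - 1) \<in> R" using assms by (intro R_H) auto
  ultimately have "cg 1 (H (p - 1) + H (p - 1)) (- H (p - 1) + H (p - 1))"
    by (intro cg_add cg_refl)
  moreover have "inverse 2 \<in> R" using unit_less[of 2] assms by simp
  ultimately have "cg 1 (inverse 2 * (H (p - 1) + H (p - 1))) (inverse 2 * (- H (p - 1) + H (p - 1)))"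
    by (intro cg_mult_left)
  then show ?thesis by simp
qed

text \<open>Starting from \<open>H_top\<close>, each step removes the top term
  \<open>1 / (p - j)\<close>, which is the same modulo \<open>p\<close> as adding
  \<open>1 / j\<close>.\<close>

lemma H_reflect: assumes "p > 2" "n < p" shows "cg 1 (H (p - 1 - n)) (H n)"
  using \<open>n < p\<close>
proof (induction n)
  case 0
  then show ?case using H_top[OF assms(1)] by simp
next
  case (Suc n)
  then have "H (p - 1 - n) = H (p - 1 - Suc n) + inverse (of_nat (p - Suc n))"
    by (simp flip: Suc_diff_Suc)
  then have "H (p - 1 - Suc n) = H (p - 1 - n) - inverse (of_nat (p - Suc n))" by simp
  moreover have "cg 1 (H (p - 1 - n) - inverse (of_nat (p - Suc n))) (H n - - inverse (of_nat (Suc n)))"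
    using Suc by (intro cg_diff inverse_reflect) auto
  ultimately show ?case by simp
qed

end

section \<open>Contiguity in the parameter\<close>

lemma of_nat_plus_1_neq_0 [simp]:
  "of_nat k + 1 \<noteq> (0 :: 'a :: field_char_0)" "1 + of_nat k \<noteq> (0 :: 'a :: field_char_0)"
  by (metis of_nat_Suc of_nat_neq_0 add.commute)+

text \<open>\<open>leg x k\<close> is \<open>(x gchoose k) * ((- 1 - x) gchoose k)\<close>.\<close>

definition leg :: "'a :: field_char_0 \<Rightarrow> nat \<Rightarrow> 'a" where
  "leg x k = (\<Prod>i<k. (of_nat i - x) * (x + of_nat i + 1) / (of_nat i + 1)\<^sup>2)"

text \<open>This is \<open>(x gchoose k) * ((- 2 - x) gchoose k)\<close>. It arises as the boundary
  term when the sums of \<open>leg x\<close> and \<open>leg (x + 1)\<close> are telescoped.\<close>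

definition leg_bd :: "'a :: field_char_0 \<Rightarrow> nat \<Rightarrow> 'a" where
  "leg_bd x k = (\<Prod>i<k. (of_nat i - x) * (x + of_nat i + 2) / (of_nat i + 1)\<^sup>2)"

lemma leg_0 [simp]: "leg x 0 = 1"
  by (simp add: leg_def)

lemma leg_Suc: "leg x (Suc k) = leg x k * ((of_nat k - x) * (x + of_nat k + 1) / (of_nat k + 1)\<^sup>2)"
  by (simp add: leg_def)

lemma leg_Suc_mult: "leg x (Suc k) * (of_nat k + 1)\<^sup>2 = leg x k * ((of_nat k - x) * (x + of_nat k + 1))"
  by (simp add: leg_Suc)

lemma leg_bd_0 [simp]: "leg_bd x 0 = 1"
  by (simp add: leg_bd_def)

lemma leg_bd_Suc:
  "leg_bd x (Suc k) = leg_bd x k * ((of_nat k - x) * (x + of_nat k + 2) / (of_nat k + 1)\<^sup>2)"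
  by (simp add: leg_bd_def)

text \<open>Replacing \<open>x\<close> by \<open>x + 1\<close> shifts both families of linear
  factors by one, so in the quotient only the end factors survive. The multiplied form stays valid
  where \<open>x + 1 - of_nat k\<close> vanishes.\<close>

lemma leg_contiguous: "(x + 1 - of_nat k) * leg (x + 1) k = (x + 1 + of_nat k) * leg x k"
proof (induction k)
  case (Suc k)
  define d :: 'a where "d = inverse ((of_nat k + 1)\<^sup>2)"
  have "(x + 1 - of_nat (Suc k)) * leg (x + 1) (Suc k)
      = (x - of_nat k) * (- ((x + of_nat k + 2) * d)) * ((x + 1 - of_nat k) * leg (x + 1) k)"
    by (simp add: leg_Suc d_def divide_inverse) Groebner_Basis.algebra
  also have "\<dots> = (x + 1 + of_nat (Suc k)) * leg x (Suc k)"
    unfolding Suc by (simp add: leg_Suc d_def divide_inverse) Groebner_Basis.algebra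
  finally show ?case .
qed simp

text \<open>Up to end factors both next summands are \<open>leg_bd x k\<close>; this supplies the
  increment in the telescoping sum that follows.\<close>

lemma leg_bd:
  "leg x (Suc k) * (of_nat k + 1)\<^sup>2 = leg_bd x k * (of_nat k - x) * (x + 1)"
  "leg (x + 1) (Suc k) * (of_nat k + 1)\<^sup>2 = - leg_bd x k * (x + 1) * (x + of_nat k + 2)"
proof (induction k)
  case 0
  { case 1 show ?case by (simp add: leg_Suc) }
  { case 2 show ?case by (simp add: leg_Suc algebra_simps) }
next
  case (Suc k)
  have d: "inverse ((of_nat k + 1)\<^sup>2) * (of_nat k + 1)\<^sup>2 = (1::'a)" by simp
  { case 1
    have "leg x (Suc k) = inverse ((of_nat k + 1)\<^sup>2) * (leg_bd x k * (of_nat k - x) * (x + 1))"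
      unfolding Suc.IH(1)[symmetric] using d by simp
    then show ?case
      unfolding leg_Suc_mult[of x "Suc k"] leg_bd_Suc by (simp add: divide_inverse mult_ac add_ac)
  }
  { case 2
    have "leg (x + 1) (Suc k) = inverse ((of_nat k + 1)\<^sup>2) * (- leg_bd x k * (x + 1) * (x + of_nat k + 2))"
      unfolding Suc.IH(2)[symmetric] using d by simp
    then show ?case
      unfolding leg_Suc_mult[of "x + 1" "Suc k"] leg_bd_Suc by (simp add: divide_inverse mult_ac add_ac)
  }
qed

lemma sum_leg_plus_leg: "(\<Sum>k\<le>N. leg (x + 1) k + leg x k) = 2 * leg_bd x N"
proof (induction N)
  case (Suc N)
  define d :: 'a where "d = inverse ((of_nat N + 1)\<^sup>2)"
  have d: "d * (of_nat N + 1)\<^sup>2 = 1" unfolding d_def by simp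
  have "leg x (Suc N) = d * (leg_bd x N * (of_nat N - x) * (x + 1))"
    "leg (x + 1) (Suc N) = d * (- leg_bd x N * (x + 1) * (x + of_nat N + 2))"
    unfolding leg_bd[symmetric] using d by (simp_all add: algebra_simps)
  moreover have "leg_bd x (Suc N) = leg_bd x N * ((of_nat N - x) * (x + of_nat N + 2) * d)"
    by (simp add: leg_bd_Suc d_def divide_inverse)
  ultimately show ?case using Suc d by simp Groebner_Basis.algebra
qed simp

text \<open>By \<open>leg_contiguous\<close>, the combination
  \<open>(x + b + 1) * leg (x + 1) k - (x + 1 - b) * leg x k\<close> equals
  \<open>(of_nat k + b) * (leg (x + 1) k + leg x k)\<close>. The denominator cancels and the rest
  telescopes.\<close>

lemma sum_leg_step:
  fixes x b :: "'a :: field_char_0"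
  assumes "\<And>k. k \<le> N \<Longrightarrow> of_nat k + b \<noteq> 0"
  shows "(x + b + 1) * (\<Sum>k\<le>N. leg (x + 1) k / (of_nat k + b))
       = (x + 1 - b) * (\<Sum>k\<le>N. leg x k / (of_nat k + b)) + 2 * leg_bd x N"
proof -
  have "(x + b + 1) * (leg (x + 1) k / (of_nat k + b)) - (x + 1 - b) * (leg x k / (of_nat k + b))
      = leg (x + 1) k + leg x k" if "k \<le> N" for k
  proof -
    define u where "u = inverse (of_nat k + b)"
    have "u * (of_nat k + b) = 1" using assms[OF that] by (simp add: u_def)
    then show ?thesis using leg_contiguous[of x k]
      unfolding divide_inverse u_def[symmetric] by Groebner_Basis.algebra
  qed
  then have "(\<Sum>k\<le>N. (x + b + 1) * (leg (x + 1) k / (of_nat k + b)) - (x + 1 - b) * (leg x k / (of_nat k + b)))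
      = 2 * leg_bd x N"
    by (simp flip: sum_leg_plus_leg)
  then show ?thesis by (simp add: sum_subtractf sum_distrib_left algebra_simps)
qed

text \<open>The factors \<open>i - x\<close> and \<open>i + x\<close> are paired into
  \<open>i^2 - x^2\<close>; unpaired remain \<open>- x\<close> and \<open>x + k + 1\<close>. For
  \<open>x\<close> divisible by \<open>p\<close> the paired part is then 1 modulo
  \<open>p^2\<close>.\<close>

lemma leg_Suc_expansion:
  "leg x (Suc k) = - (x / of_nat (Suc k)) * (1 + x / of_nat (Suc k)) * (\<Prod>i=1..k. 1 - x\<^sup>2 / (of_nat i)\<^sup>2)"
proof (induction k)
  case 0
  then show ?case by (simp add: leg_Suc algebra_simps)
next
  case (Suc k)
  have *: "x / s * (1 + x / s) * ((s - x) * (x + s + 1) / (s + 1)\<^sup>2)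
      = x / (s + 1) * (1 + x / (s + 1)) * (1 - x\<^sup>2 / s\<^sup>2)" if "s \<noteq> 0" "s + 1 \<noteq> 0" for s
    using that by (simp add: divide_simps) Groebner_Basis.algebra
  have "leg x (Suc (Suc k)) = - (x / of_nat (Suc k) * (1 + x / of_nat (Suc k))
      * ((of_nat (Suc k) - x) * (x + of_nat (Suc k) + 1) / (of_nat (Suc k) + 1)\<^sup>2))
      * (\<Prod>i=1..k. 1 - x\<^sup>2 / (of_nat i)\<^sup>2)"
    unfolding leg_Suc[of x "Suc k"] Suc.IH by (simp only: mult_ac mult_minus_left mult_minus_right)
  also have "\<dots> = - (x / (of_nat (Suc k) + 1) * (1 + x / (of_nat (Suc k) + 1)) * (1 - x\<^sup>2 / (of_nat (Suc k))\<^sup>2))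
      * (\<Prod>i=1..k. 1 - x\<^sup>2 / (of_nat i)\<^sup>2)"
    by (subst *) (simp_all del: of_nat_Suc)
  finally show ?case by (simp add: add_ac mult_ac)
qed

section \<open>The sum modulo the square of the prime\<close>

context prime_localization
begin

lemma cg_exponent_mono:
  assumes "cg e x y" "f \<le> e"
  shows "cg f x y"
proof -
  obtain c where c: "c \<in> R" "x = y + P ^ e * c" "x \<in> R" "y \<in> R" using assms(1) by (elim cgE)
  have "P ^ e = P ^ f * P ^ (e - f)" using assms(2) by (simp flip: power_add)
  then show ?thesis using c by (intro cgI'[of _ "P ^ (e - f) * c"]) (auto intro!: R_intros)
qed

text \<open>Partial fractions: \<open>1 / (k * (k + c)) = (1 / k - 1 / (k + c)) / c\<close>. Each of
  the two sums runs over all nonzero residues but one, so by \<open>H_top\<close> they are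
  \<open>1 / c\<close> and \<open>- 1 / c\<close>. The index \<open>p - c\<close> is left out
  because there \<open>k + c = p\<close>.\<close>

lemma sum_inverse_shift:
  assumes "p > 2" "0 < c" "c < p"
  shows "cg 1 (\<Sum>k\<in>{1..p-1} - {p - c}. inverse (of_nat k) * inverse (of_nat (k + c)))
              (2 * (inverse (of_nat c))\<^sup>2)"
proof -
  let ?A = "{1..p-1} - {p - c}" and ?u = "inverse (of_nat c :: rat)"
  have u: "?u \<in> R" using assms by (intro unit_less)
  have minus: "(\<Sum>k\<in>{1..p-1} - {j}. inverse (of_nat k)) = H (p - 1) - inverse (of_nat j)"
    if "j \<in> {1..p-1}" for j using that by (simp add: sum_diff1)
  have ndvd: "\<not> p dvd k + c" if "k \<in> ?A" for k
  proof
    assume "p dvd k + c"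
    then obtain d where d: "k + c = p * d" by blast
    have "k + c < p * 2" "0 < k + c" using that assms by auto
    then have "p * d < p * 2" "0 < d" unfolding d by auto
    then have "d = 1" by simp
    then show False using d that by auto
  qed
  have "cg 1 (H (p - 1) - inverse (of_nat (p - c))) (0 - - ?u)"
    using assms by (intro cg_diff H_top inverse_reflect)
  then have "cg 1 (\<Sum>k\<in>?A. inverse (of_nat k)) (0 - - ?u)"
    by (subst minus) (use assms in auto)
  moreover have "cg 1 (\<Sum>k\<in>?A. inverse (of_nat (k + c))) (0 - ?u)"
  proof -
    \<comment> \<open>\<open>?f\<close> reduces \<open>k + c\<close> modulo \<open>p\<close>. The
      residue \<open>c\<close> is missed because \<open>k = 0\<close> is not in the range, and 0 is
      missed because \<open>p - c\<close> was removed.\<close>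
    let ?f = "\<lambda>k. if k + c < p then k + c else k + c - p"
    have "cg 1 (inverse (of_nat (k + c))) (inverse (of_nat (?f k)))" if k: "k \<in> ?A" for k
    proof (cases "k + c < p")
      case True
      then show ?thesis using unit_of_nat[OF ndvd[OF k]] by (simp add: cg_refl del: of_nat_add)
    next
      case False
      then have f: "0 < ?f k" "?f k < p" using k assms by auto
      have "cg 1 (inverse (of_nat (?f k) + P * 1)) (inverse (of_nat (?f k)))"
        using unit_less[OF f] f by (intro cg_inverse_shift(1)) (auto intro!: R_intros)
      moreover have "of_nat (k + c) = of_nat (?f k) + P * 1" using False by (simp add: of_nat_diff)
      ultimately show ?thesis by (simp only:)
    qed
    then have "cg 1 (\<Sum>k\<in>?A. inverse (of_nat (k + c))) (\<Sum>k\<in>?A. inverse (of_nat (?f k)))"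
      by (intro cg_sum)
    also have "(\<Sum>k\<in>?A. inverse (of_nat (?f k)) :: rat) = (\<Sum>k\<in>{1..p-1} - {c}. inverse (of_nat k))"
    proof (rule sum.reindex_bij_witness[of _ "\<lambda>j. if j > c then j - c else j + p - c" ?f])
      fix k assume "k \<in> ?A"
      then have "1 \<le> k" "k < p" "k + c \<noteq> p" by auto
      then show "(if ?f k > c then ?f k - c else ?f k + p - c) = k" "?f k \<in> {1..p-1} - {c}"
        using assms by auto
    next
      fix k assume "k \<in> {1..p-1} - {c}"
      then have "1 \<le> k" "k < p" "k \<noteq> c" by auto
      then show "?f (if k > c then k - c else k + p - c) = k" "(if k > c then k - c else k + p - c) \<in> ?A"
        using assms by auto
    qed simp
    also have "(\<Sum>k\<in>{1..p-1} - {c}. inverse (of_nat k)) = H (p - 1) - ?u"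
      using assms by (intro minus) auto
    also have "cg 1 \<dots> (0 - ?u)" using assms u by (intro cg_diff H_top cg_refl)
    finally show ?thesis .
  qed
  ultimately have "cg 1 (?u * ((\<Sum>k\<in>?A. inverse (of_nat k)) - (\<Sum>k\<in>?A. inverse (of_nat (k + c)))))
      (?u * ((0 - - ?u) - (0 - ?u)))"
    using u by (intro cg_mult_left cg_diff)
  moreover have "?u * ((\<Sum>k\<in>?A. inverse (of_nat k)) - (\<Sum>k\<in>?A. inverse (of_nat (k + c))))
      = (\<Sum>k\<in>?A. inverse (of_nat k) * inverse (of_nat (k + c)))"
    unfolding sum_subtractf[symmetric] sum_distrib_left
    using assms by (intro sum.cong) (auto simp: field_simps)
  ultimately show ?thesis by (simp add: power2_eq_square algebra_simps)
qed

text \<open>The factor \<open>1 + P * (t / k)\<close> is kept, and \<open>w\<close> is controlled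
  modulo \<open>p^2\<close>, because at one index the denominator will cancel the leading
  \<open>P\<close>.\<close>

lemma leg_multiple_of_p:
  assumes "0 < k" "k < p" "t \<in> R"
  obtains w where "leg (P * t) k = - (P * (t * inverse (of_nat k))) * (1 + P * (t * inverse (of_nat k))) * w" "cg 2 w 1"
proof
  define w where "w = (\<Prod>i=1..k-1. 1 - (P * t)\<^sup>2 / (of_nat i)\<^sup>2)"
  have "cg 2 w (\<Prod>i=1..k-1. 1)" unfolding w_def
  proof (rule cg_prod)
    fix i assume i: "i \<in> {1..k-1}"
    have "inverse (of_nat i) \<in> R" using i assms by (intro unit_less) auto
    then show "cg 2 (1 - (P * t)\<^sup>2 / (of_nat i)\<^sup>2) 1" using assms(3)
      by (intro cgI'[of _ "- (t * inverse (of_nat i))\<^sup>2"] R_uminus R_power R_mult R_numeral)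
         (auto simp: power_mult_distrib divide_inverse power_inverse)
  qed
  then show "cg 2 w 1" by simp
  show "leg (P * t) k = - (P * (t * inverse (of_nat k))) * (1 + P * (t * inverse (of_nat k))) * w"
    using leg_Suc_expansion[of "P * t" "k - 1"] assms by (simp add: w_def divide_inverse mult_ac)
qed

end

text \<open>The bound \<open>2 * n + 1 < p\<close> makes the integers from \<open>n + 1\<close> to
  \<open>2 * n + 1\<close> prime to \<open>p\<close>. The number \<open>1 + t\<close> is the
  cofactor of \<open>p\<close> in the only denominator of the sum that \<open>p\<close>
  divides.\<close>

locale shifted_residue = prime_localization +
  fixes n :: nat and t :: rat
  assumes p_gt_2: "p > 2" and n_less: "2 * n + 1 < p"
    and t: "t \<in> R" and t': "unit (1 + t)" "1 + t \<noteq> 0"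
begin

abbreviation c :: nat where "c \<equiv> Suc n"

text \<open>The shift in the denominators is frozen at its final value
  \<open>1 + (of_nat n + P * t)\<close>; only the parameter of \<open>leg\<close> varies, as
  \<open>sum_leg_step\<close> requires.\<close>

abbreviation F :: "rat \<Rightarrow> rat" where
  "F x \<equiv> \<Sum>k\<le>p-1. leg x k / (of_nat k + (of_nat c + P * t))"

lemma unit_denominator:
  assumes "k < p" "k \<noteq> p - c"
  shows "unit (of_nat k + (of_nat c + P * t))" "of_nat k + (of_nat c + P * t) \<noteq> 0"
    "unit (of_nat (k + c))" 
proof -
  have "\<not> p dvd k + c"
  proof
    assume "p dvd k + c"
    then obtain d where d: "k + c = p * d" by blast
    have "k + c < p * 2" "0 < k + c" using n_less assms by auto
    then have "p * d < p * 2" "0 < d" unfolding d by auto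
    then have "d = 1" by simp
    then show False using d assms by auto
  qed
  then show u: "unit (of_nat (k + c))" by (rule unit_of_nat)
  have "of_nat (k + c) \<noteq> (0::rat)" by (simp del: of_nat_add)
  from unit_add_multiple[OF R_of_nat u t this]
  show "unit (of_nat k + (of_nat c + P * t))" "of_nat k + (of_nat c + P * t) \<noteq> 0"
    by (simp_all add: add_ac)
qed

lemma singular_denominator: "of_nat (p - c) + (of_nat c + P * t) = P * (1 + t)"
  using n_less by (simp add: of_nat_diff algebra_simps)

lemma denominator_nonzero: "k \<le> p - 1 \<Longrightarrow> of_nat k + (of_nat c + P * t) \<noteq> 0"
  using unit_denominator(2)[of k] singular_denominator t' p_gt_2 by (cases "k = p - c") auto

text \<open>The indices \<open>0\<close>, \<open>p - c\<close> and all others are treated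
  separately. Over the common factor \<open>1 / (1 + t)\<close> the three contributions combine to
  \<open>(1 + 2 * t) * (u - 2 * P * t * u^2)\<close>, the truncated expansion of the right-hand
  side.\<close>

lemma F_at_multiple_of_p:
  "cg 2 (F (P * t)) ((1 + 2 * t) / (1 + t) * inverse (of_nat c + 2 * P * t))"
proof -
  define u v where "u = inverse (of_nat c :: rat)" and "v = inverse (1 + t)"
  have c: "0 < c" "c < p" using n_less by auto
  have R: "u \<in> R" "v \<in> R" unfolding u_def v_def using unit_less[OF c] t' by auto
  let ?A = "{1..p-1} - {p - c}"
  let ?g = "\<lambda>k. leg (P * t) k / (of_nat k + (of_nat c + P * t))"
  have split: "F (P * t) = ?g 0 + ?g (p - c) + sum ?g ?A"
  proof -
    have "sum g {..p-1} = g 0 + g (p - c) + sum g ?A" for g :: "nat \<Rightarrow> rat"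
    proof -
      have "{..p-1} - {0} = {1..p-1}" by auto
      then have "sum g {..p-1} = g 0 + sum g {1..p-1}"
        using sum.remove[of "{..p-1}" 0 g] by simp
      moreover have "sum g {1..p-1} = g (p - c) + sum g ?A"
        by (rule sum.remove) (use c in auto)
      ultimately show ?thesis by simp
    qed
    then show ?thesis .
  qed
  have g0: "cg 2 (?g 0) (u - P * t * u\<^sup>2)"
    using cg_inverse_shift(2)[of "of_nat c" t] unit_less[OF c] t
    by (simp add: u_def divide_inverse R_of_nat del: of_nat_Suc)
  \<comment> \<open>Here the \<open>P\<close> in \<open>leg\<close> cancels against the denominator
    \<open>P * (1 + t)\<close>. The reciprocal of \<open>p - c\<close> is thus needed to first order
    in \<open>P\<close>, not only modulo \<open>p\<close>.\<close>
  have g1: "cg 2 (?g (p - c)) (t * v * (u + P * u\<^sup>2 - P * t * u\<^sup>2))"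
  proof -
    define w where "w = inverse (of_nat (p - c) :: rat)"
    have w: "cg 2 w (- u - P * u\<^sup>2)"
    proof -
      have "cg 2 (inverse (- of_nat c + P * 1)) (inverse (- of_nat c) - P * 1 * (inverse (- of_nat c))\<^sup>2)"
        using c unit_less[OF c] by (intro cg_inverse_shift(2)) (auto intro!: R_intros simp del: of_nat_Suc)
      then show ?thesis using c by (simp add: w_def u_def of_nat_diff del: of_nat_Suc)
    qed
    obtain y where y: "leg (P * t) (p - c) = - (P * (t * w)) * (1 + P * (t * w)) * y" "cg 2 y 1"
      using leg_multiple_of_p[of "p - c" t] c t unfolding w_def by auto
    have "?g (p - c) = - (t * v * (w * ((1 + P * (t * w)) * y)))"
    proof -
      have "- (q * (t * w)) * a * y * (q' * v) = - (t * v * (w * (a * y)))" if "q * q' = 1" for q q' a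
        using that by Groebner_Basis.algebra
      then show ?thesis
        unfolding singular_denominator y divide_inverse inverse_mult_distrib v_def[symmetric] by simp
    qed
    also have "cg 2 \<dots> (- (t * v * ((- u - P * u\<^sup>2) * ((1 + P * (t * (- u - P * u\<^sup>2))) * 1))))"
      using y R t w by (intro cg_uminus cg_mult_left cg_mult cg_add) (auto intro: cg_refl R_intros)
    also have "cg 2 \<dots> (t * v * (u + P * u\<^sup>2 - P * t * u\<^sup>2))"
    proof (rule cgI'[of _ "- (t * v) * (t * u ^ 3 + t * u\<^sup>2 * (u + P * u\<^sup>2))"])
      show "- (t * v * ((- u - P * u\<^sup>2) * ((1 + P * (t * (- u - P * u\<^sup>2))) * 1))) =
        t * v * (u + P * u\<^sup>2 - P * t * u\<^sup>2) + P\<^sup>2 * (- (t * v) * (t * u ^ 3 + t * u\<^sup>2 * (u + P * u\<^sup>2)))"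
        by Groebner_Basis.algebra
    qed (use R t in \<open>auto intro!: R_intros\<close>)
    finally show ?thesis .
  qed
  \<comment> \<open>All remaining summands keep their factor \<open>P\<close>, so the cofactors
    matter only modulo \<open>p\<close> and \<open>sum_inverse_shift\<close> evaluates them.\<close>
  have g2: "cg 2 (sum ?g ?A) (P * (- t * (2 * u\<^sup>2)))"
  proof -
    have "cg 2 (?g k) (P * (- t * (inverse (of_nat k) * inverse (of_nat (k + c)))))" if k: "k \<in> ?A" for k
    proof -
      have k': "0 < k" "k < p" "k \<noteq> p - c" using k by auto
      have ku: "unit (of_nat k)" using k' by (intro unit_less)
      note un = unit_denominator[OF k'(2,3)]
      obtain y where y: "leg (P * t) k = - (P * (t * inverse (of_nat k))) * (1 + P * (t * inverse (of_nat k))) * y" "cg 2 y 1"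
        using leg_multiple_of_p[OF k'(1,2) t] by auto
      have "?g k = P * (- t * (inverse (of_nat k) * (1 + P * (t * inverse (of_nat k))) * y * inverse (of_nat (k + c) + P * t)))"
        unfolding y by (simp add: divide_inverse mult_ac add_ac)
      also have "cg 2 \<dots> (P * (- t * (inverse (of_nat k) * 1 * 1 * inverse (of_nat (k + c)))))"
      proof (intro cg_P_mult_1 cg_mult_left cg_mult cg_inverse_shift(1))
        show "cg 1 (1 + P * (t * inverse (of_nat k))) 1"
          using ku t by (intro cgI'[of _ "t * inverse (of_nat k)"]) (auto intro!: R_intros)
        show "cg 1 y 1" using y(2) by (rule cg_exponent_mono) simp
      qed (use ku t un(3) R_of_nat[of "k + c"] in \<open>simp_all add: R_uminus add_ac k'\<close>)
      finally show ?thesis by (simp only: mult_1_right)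
    qed
    then have "cg 2 (sum ?g ?A) (\<Sum>k\<in>?A. P * (- t * (inverse (of_nat k) * inverse (of_nat (k + c)))))"
      by (intro cg_sum)
    also have "\<dots> = P * (- t * (\<Sum>k\<in>?A. inverse (of_nat k) * inverse (of_nat (k + c))))"
      by (simp add: sum_distrib_left)
    also have "cg 2 \<dots> (P * (- t * (2 * u\<^sup>2)))"
      unfolding u_def using t c p_gt_2 by (intro cg_P_mult_1 cg_mult_left sum_inverse_shift R_uminus)
    finally show ?thesis .
  qed
  have vt: "v * (1 + t) = 1" unfolding v_def using t' by simp
  have "cg 2 (F (P * t)) (u - P * t * u\<^sup>2 + t * v * (u + P * u\<^sup>2 - P * t * u\<^sup>2) + P * (- t * (2 * u\<^sup>2)))"
    unfolding split using g0 g1 g2 by (intro cg_add)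
  also have "\<dots> = (1 + 2 * t) * v * (u - P * (2 * t) * u\<^sup>2)"
    using vt by Groebner_Basis.algebra
  also have "cg 2 \<dots> ((1 + 2 * t) * v * inverse (of_nat c + P * (2 * t)))"
    unfolding u_def using R t unit_less[OF c] c
    by (intro cg_mult_left cg_sym[OF cg_inverse_shift(2)]) (auto intro!: R_intros simp del: of_nat_Suc)
  finally show ?thesis by (simp add: v_def divide_inverse mult_ac)
qed

section \<open>Climbing from \<open>F (P * t)\<close> to \<open>F (of_nat n + P * t)\<close>\<close>

lemma leg_bd_divisible:
  assumes "j < p - 1" "s \<in> R"
  obtains y where "y \<in> R" "leg_bd (of_nat j + P * s) (p - 1) = P\<^sup>2 * y"
proof -
  let ?x = "of_nat j + P * s"
  let ?y1 = "\<Prod>i\<in>{..<p-1} - {j}. of_nat i - ?x" and ?y2 = "\<Prod>i\<in>{..<p-1} - {p - 2 - j}. ?x + of_nat i + 2"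
  \<comment> \<open>Each of the two products contributes one \<open>p\<close>: the index
    \<open>i = j\<close> gives \<open>- P * s\<close> in the first, and \<open>i = p - 2 - j\<close>
    gives \<open>P * (1 + s)\<close> in the second. The denominator \<open>(p - 1)!\<close> squared
    is a unit.\<close>
  have y1: "(\<Prod>i<p-1. of_nat i - ?x) = P * (- s * ?y1)"
    using assms by (subst prod.remove[of _ j]) auto
  have y2: "(\<Prod>i<p-1. ?x + of_nat i + 2) = P * ((1 + s) * ?y2)"
    using assms by (subst prod.remove[of _ "p - 2 - j"]) (auto simp: of_nat_diff algebra_simps)
  have y3: "(\<Prod>i<p-1. (of_nat i + 1 :: rat)\<^sup>2) = (fact (p - 1))\<^sup>2"
    by (simp add: fact_prod_Suc prod_power_distrib add.commute flip: atLeast0LessThan)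
  have "leg_bd ?x (p - 1) = P\<^sup>2 * ((- s * ?y1) * ((1 + s) * ?y2) * (inverse (fact (p - 1)))\<^sup>2)"
    unfolding leg_bd_def prod_dividef prod.distrib y1 y2 y3
    by (simp add: power2_eq_square divide_inverse)
  moreover have "unit (fact (p - 1))" using p_gt_2 by (intro unit_fact) auto
  then have "(- s * ?y1) * ((1 + s) * ?y2) * (inverse (fact (p - 1)))\<^sup>2 \<in> R"
    using assms(2) by (intro R_intros)
  ultimately show ?thesis using that by blast
qed

lemma unit_step:
  assumes "j < n"
  shows "unit (of_nat (j + n + 2) + 2 * P * t)" "of_nat (j + n + 2) + 2 * P * t \<noteq> 0"
proof -
  have "unit (of_nat (j + n + 2))" using assms n_less by (intro unit_less) auto
  moreover have "of_nat (j + n + 2) \<noteq> (0::rat)" by (simp del: of_nat_add)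
  moreover have "2 * t \<in> R" using t by (intro R_intros)
  ultimately show "unit (of_nat (j + n + 2) + 2 * P * t)" "of_nat (j + n + 2) + 2 * P * t \<noteq> 0"
    using unit_add_multiple[of "of_nat (j + n + 2)" "2 * t"] R_of_nat[of "j+n+2"] by (simp_all add: mult_ac)
qed

text \<open>Iterates \<open>sum_leg_step\<close>, whose boundary term vanishes modulo
  \<open>p^2\<close> by \<open>leg_bd_divisible\<close>. Division by \<open>x + b + 1\<close> is
  possible since \<open>j + n + 2 <= 2 * n + 1 < p\<close>.\<close>

lemma F_induct:
  assumes "j \<le> n"
  shows "cg 2 (F (of_nat j + P * t)) (F (P * t) * (\<Prod>i<j. (of_nat i - of_nat n) * inverse (of_nat (i + n + 2) + 2 * P * t)))"
  using assms
proof (induction j)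
  case 0
  have "F (P * t) \<in> R" using F_at_multiple_of_p by (elim cgE)
  then show ?case by (simp add: cg_refl)
next
  case (Suc j)
  let ?x = "of_nat j + P * t"
  let ?d = "of_nat (j + n + 2) + 2 * P * t"
  have j: "j < n" using Suc by simp
  obtain y where y: "y \<in> R" "leg_bd ?x (p - 1) = P\<^sup>2 * y"
  proof (rule leg_bd_divisible[OF _ t])
    show "j < p - 1" using j n_less by simp
  qed
  \<comment> \<open>The two occurrences of \<open>P * t\<close> add up in the divisor and cancel in
    the multiplier, which is therefore a plain integer.\<close>
  have eqs: "?x + (of_nat c + P * t) + 1 = ?d" "?x + 1 - (of_nat c + P * t) = of_nat j - of_nat n"
    by simp_all
  have "(?x + (of_nat c + P * t) + 1) * F (?x + 1)
      = (?x + 1 - (of_nat c + P * t)) * F ?x + 2 * leg_bd ?x (p - 1)"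
    by (rule sum_leg_step, rule denominator_nonzero)
  then have step: "?d * F (?x + 1) = (of_nat j - of_nat n) * F ?x + 2 * (P\<^sup>2 * y)"
    unfolding eqs y(2) .
  have "a = b * (e * w) + q * (2 * z * w)" if "d * a = e * b + 2 * (q * z)" "d * w = 1"
    for a b d e w q z :: rat
    using that by Groebner_Basis.algebra
  from this[OF step right_inverse[OF unit_step(2)[OF j]]]
  have eq: "F (?x + 1) = F ?x * ((of_nat j - of_nat n) * inverse ?d) + P\<^sup>2 * (2 * y * inverse ?d)" .
  have IH: "cg 2 (F ?x) (F (P * t) * (\<Prod>i<j. (of_nat i - of_nat n) * inverse (of_nat (i + n + 2) + 2 * P * t)))"
    using Suc by simp
  then have "F ?x \<in> R" by (elim cgE)
  then have "cg 2 (F (?x + 1)) (F ?x * ((of_nat j - of_nat n) * inverse ?d))"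
    using y(1) unit_step(1)[OF j]
    by (intro cgI'[OF _ _ eq] R_mult R_diff R_of_nat R_numeral)
  also have "cg 2 \<dots> (F (P * t) * (\<Prod>i<j. (of_nat i - of_nat n) * inverse (of_nat (i + n + 2) + 2 * P * t)) * ((of_nat j - of_nat n) * inverse ?d))"
    using IH unit_step(1)[OF j] by (intro cg_mult cg_refl R_mult R_diff R_of_nat)
  finally show ?case by (simp add: mult_ac add_ac)
qed

text \<open>The multipliers \<open>i - n\<close> give \<open>(- 1) ^ n * fact n\<close>; the
  divisors together with the one in \<open>F_at_multiple_of_p\<close> fill the interval from
  \<open>n + 1\<close> to \<open>2 * n + 1\<close>.\<close>

lemma F_eq:
  "cg 2 (F (of_nat n + P * t))
     ((1 + 2 * t) / (1 + t) * ((- 1) ^ n * fact n / (\<Prod>i=n+1..2*n+1. of_nat i + 2 * P * t)))"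
proof -
  let ?Q = "\<Prod>i<n. (of_nat i - of_nat n) * inverse (of_nat (i + n + 2) + 2 * P * t)"
  have QR: "?Q \<in> R" using unit_step by (intro R_intros) auto
  have main: "cg 2 (F (of_nat n + P * t)) ((1 + 2 * t) / (1 + t) * inverse (of_nat c + 2 * P * t) * ?Q)"
    by (rule cg_trans[OF F_induct[OF order_refl] cg_mult[OF F_at_multiple_of_p cg_refl[OF QR]]])
  have Q: "?Q = (- 1) ^ n * fact n * inverse (\<Prod>i<n. of_nat (i + n + 2) + 2 * P * t)"
  proof -
    have "(\<Prod>i<n. of_nat i - of_nat n :: rat) = (\<Prod>i<n. (-1) * of_nat (n - i))"
      by (intro prod.cong) (auto simp: of_nat_diff)
    also have "\<dots> = (-1) ^ n * fact n"
      unfolding prod.distrib by (simp add: fact_prod_rev atLeast0LessThan)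
    finally show ?thesis
      unfolding prod.distrib using prod_inversef[of "\<lambda>i. of_nat (i + n + 2) + 2 * P * t" "{..<n}"]
      by (simp add: comp_def)
  qed
  have D: "(\<Prod>i=n+1..2*n+1. of_nat i + 2 * P * t) = (of_nat c + 2 * P * t) * (\<Prod>i<n. of_nat (i + n + 2) + 2 * P * t)"
  proof -
    have "{n+1..2*n+1} = insert c {n+2..2*n+1}" by auto
    moreover have "(\<Prod>i=n+2..2*n+1. of_nat i + 2 * P * t) = (\<Prod>i<n. of_nat (i + n + 2) + 2 * P * t)"
      by (rule prod.reindex_bij_witness[of _ "\<lambda>i. i + n + 2" "\<lambda>i. i - n - 2"]) auto
    ultimately show ?thesis by simp
  qed
  have "a * inverse b * (d * inverse e) = a * (d / (b * e))" for a b d e :: rat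
    by (simp add: divide_inverse)
  then show ?thesis using main unfolding Q D by (simp only:)
qed

end

section \<open>Harmonic numbers and products modulo the square of the prime\<close>

lemma fact_eq_prod_interval: "n \<le> q \<Longrightarrow> fact q = fact n * (\<Prod>i=n+1..q. of_nat i :: rat)"
proof (induction q rule: dec_induct)
  case (step q)
  then show ?case by simp
qed simp

section \<open>Alternating harmonic numbers and the Fermat quotient of 2\<close>

definition alt_harm :: "nat \<Rightarrow> rat" where
  "alt_harm n = (\<Sum>k=1..n. (- 1) ^ (k + 1) * inverse (of_nat k))"

lemma alt_harm_Suc: "alt_harm (Suc n) = alt_harm n + (- 1) ^ n * inverse (of_nat (Suc n))"
  by (simp add: alt_harm_def)

context prime_localization
begin

text \<open>The signs amount to subtracting the terms of even index twice, and
  \<open>2 / (2 * j) = 1 / j\<close>.\<close>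

lemma alt_harm_eq: "alt_harm n = H n - H (n div 2)"
proof (induction n)
  case 0
  then show ?case by (simp add: alt_harm_def)
next
  case (Suc n)
  show ?case
  proof (cases "even n")
    case True
    then show ?thesis using Suc by (simp add: alt_harm_Suc)
  next
    case False
    then obtain m where m: "n = 2 * m + 1" by (elim oddE)
    then have "Suc n div 2 = Suc m" "n div 2 = m" by simp_all
    then have "H (Suc n) - H (Suc n div 2) = H n - H m + (inverse (of_nat (Suc n)) - inverse (of_nat (Suc m)))"
      by (simp add: algebra_simps)
    also have "inverse (of_nat (Suc n)) - inverse (of_nat (Suc m)) = - inverse (of_nat (Suc n) :: rat)"
    proof -
      have "of_nat (Suc n) = (2 * of_nat (Suc m) :: rat)" unfolding m by simp
      then show ?thesis by (simp only: inverse_mult_distrib) simp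
    qed
    finally show ?thesis using Suc False \<open>n div 2 = m\<close> unfolding alt_harm_Suc by simp
  qed
qed

text \<open>By \<open>prod_shift\<close> the product \<open>Q\<close> is
  \<open>N * (1 + P * z)\<close>. Multiplying this congruence by
  \<open>fact n * (1 - P * z) / (N * Q)\<close> inverts it, because
  \<open>(1 - P * z) * (1 + P * z)\<close> is 1 modulo \<open>p^2\<close>.\<close>

lemma inverse_prod_shift:
  assumes "n \<le> q" "q < p" "s \<in> R"
  shows "cg 2 (fact n / (\<Prod>i=n+1..q. of_nat i + P * s))
              ((fact n)\<^sup>2 / fact q * (1 - P * s * (H q - H n)))"
proof -
  define Q where "Q = (\<Prod>i=n+1..q. of_nat i + P * s)"
  define N where "N = (\<Prod>i=n+1..q. (of_nat i :: rat))"
  define z where "z = s * (H q - H n)"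
  have i: "0 < i" "i < p" "\<not> p dvd i" if "i \<in> {n+1..q}" for i
    using that assms by (auto simp: nat_dvd_not_less)
  have Qu: "unit Q" "Q \<noteq> 0"
    unfolding Q_def using unit_add_multiple[OF R_of_nat unit_of_nat assms(3)] i by (auto intro!: unit_prod)
  have N: "fact q = fact n * N" unfolding N_def using assms(1) by (rule fact_eq_prod_interval)
  have Nu: "unit N" "N \<noteq> 0" unfolding N_def using i unit_of_nat by (auto intro!: unit_prod)
  have "H q - H n = (\<Sum>i=n+1..q. inverse (of_nat i))"
    using assms sum.ub_add_nat[of 1 n "\<lambda>i. inverse (of_nat i :: rat)" "q - n"] by simp
  then have "cg 2 Q (N * (1 + P * z))"
    unfolding Q_def N_def z_def using prod_shift[of "{n+1..q}" s] i assms by (simp add: mult.assoc)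
  moreover have z: "z \<in> R" unfolding z_def using assms by (intro R_mult R_diff R_H) auto
  moreover have f: "fact n \<in> R" by (rule R_fact)
  ultimately have "cg 2 (fact n * inverse N * (1 - P * z) * inverse Q * Q)
      (fact n * inverse N * (1 - P * z) * inverse Q * (N * (1 + P * z)))"
    using Nu Qu by (intro cg_mult_left R_mult R_diff R_numeral R_of_nat)
  also have "cg 2 \<dots> (fact n * inverse Q)"
  proof (rule cgI')
    have "f * n' * (1 - y * z) * q' * (n * (1 + y * z)) = f * q' + y\<^sup>2 * (- (f * q' * z\<^sup>2))"
      if "n * n' = 1" for f y q' n n' :: rat using that by Groebner_Basis.algebra
    then show "fact n * inverse N * (1 - P * z) * inverse Q * (N * (1 + P * z))
        = fact n * inverse Q + P\<^sup>2 * (- (fact n * inverse Q * z\<^sup>2))" using Nu by simp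
  qed (use f z Qu in \<open>auto intro: R_mult R_uminus R_power\<close>)
  finally have "cg 2 (fact n * inverse N * (1 - P * z)) (fact n * inverse Q)"
    using Qu by (simp add: mult.assoc)
  moreover have "fact n * inverse N * (1 - P * z) = (fact n)\<^sup>2 / fact q * (1 - P * s * (H q - H n))"
    unfolding N z_def by (simp add: power2_eq_square divide_inverse mult.assoc)
  ultimately show ?thesis unfolding Q_def[symmetric] by (simp add: divide_inverse cg_sym)
qed

text \<open>For \<open>n + q = p - 1\<close> the harmonic difference vanishes modulo
  \<open>p\<close> by \<open>H_reflect\<close>, so the linear correction disappears. Both cases of
  \<open>m = 3\<close> have this shape.\<close>

lemma inverse_prod_shift_reflect:
  assumes "p > 2" "n \<le> q" "n + q + 1 = p" "s \<in> R"
  shows "cg 2 (fact n / (\<Prod>i=n+1..q. of_nat i + P * s)) ((fact n)\<^sup>2 / fact q)"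
proof -
  have "cg 1 (H q) (H n)" using H_reflect[of n] assms by (simp add: eq_diff_iff flip: assms(3))
  moreover have "H n \<in> R" using assms by (intro R_H) auto
  ultimately have "cg 1 (s * (H q - H n)) (s * (H n - H n))"
    using assms by (intro cg_mult_left cg_diff cg_refl)
  note 1 = cg_diff[OF cg_refl[OF R_numeral(3)] cg_P_mult_1[OF this]]
  have "unit (fact q)" using assms by (intro unit_fact) simp
  then have "(fact n)\<^sup>2 / fact q \<in> R" by (intro R_divide R_power R_fact)
  note 2 = cg_mult_left[OF this 1]
  have "cg 2 (fact n / (\<Prod>i=n+1..q. of_nat i + P * s))
              ((fact n)\<^sup>2 / fact q * (1 - P * s * (H q - H n)))"
    using assms by (intro inverse_prod_shift) auto
  then show ?thesis using cg_trans[OF _ 2] by (simp add: mult.assoc)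
qed

lemma prod_shift_1:
  assumes "n \<le> q" "q < p" "s \<in> R"
  shows "cg 1 (\<Prod>i=n+1..q. of_nat i + P * s) (fact q / fact n)"
proof -
  have "cg 1 (\<Prod>i=n+1..q. of_nat i + P * s) (\<Prod>i=n+1..q. of_nat i)"
    using assms by (intro cg_prod cgI'[of _ s]) (auto intro: R_of_nat)
  then show ?thesis using fact_eq_prod_interval[OF assms(1)] by simp
qed

text \<open>Pascal's rule with \<open>p\<close> dividing \<open>p choose Suc j\<close>: consecutive
  entries of row \<open>p - 1\<close> are opposite modulo \<open>p\<close>.\<close>

lemma binomial_pred_prime: "j < p \<Longrightarrow> cg 1 (of_nat ((p - 1) choose j)) ((- 1) ^ j)"
proof (induction j)
  case 0
  then show ?case by (simp add: cg_refl R_numeral)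
next
  case (Suc j)
  have "p choose Suc j = ((p - 1) choose Suc j) + ((p - 1) choose j)"
    using binomial_Suc_Suc[of "p - 1" j] Suc.prems by simp
  moreover have "p dvd (p choose Suc j)" using Suc.prems prime_p by (intro dvd_choose_prime) auto
  then obtain d where "p choose Suc j = p * d" by blast
  ultimately have "of_nat ((p - 1) choose Suc j) = - of_nat ((p - 1) choose j) + P ^ 1 * of_nat d"
    by (metis add_diff_cancel_right' diff_conv_add_uminus add.commute of_nat_add of_nat_mult power_one_right)
  then have "cg 1 (of_nat ((p - 1) choose Suc j)) (- of_nat ((p - 1) choose j))"
    by (intro cgI'[of _ "of_nat d"]) (auto intro: R_uminus R_of_nat)
  also have "cg 1 \<dots> (- ((- 1) ^ j))" using Suc by (intro cg_uminus) simp
  finally show ?case by simp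
qed

text \<open>Expand \<open>(1 + 1) ^ p\<close> and write the inner coefficients as
  \<open>p / k\<close> times an entry of row \<open>p - 1\<close>. Because of the factor
  \<open>p\<close>, that entry may be replaced by its sign.\<close>

lemma two_power_alt_harm:
  assumes "p > 2"
  shows "cg 2 (2 ^ p - 2) (P * alt_harm (p - 1))"
proof -
  have "(2::rat) ^ p = (\<Sum>k\<le>p. of_nat (p choose k))"
    by (metis choose_row_sum of_nat_numeral of_nat_power of_nat_sum)
  also have "{..p} = insert 0 (insert p {1..p-1})" using assms by auto
  finally have "(2::rat) ^ p - 2 = (\<Sum>k=1..p-1. of_nat (p choose k))" using assms by simp
  also have "\<dots> = (\<Sum>k=1..p-1. P * (inverse (of_nat k) * of_nat ((p - 1) choose (k - 1))))"
  proof (intro sum.cong refl)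
    fix k assume k: "k \<in> {1..p-1}"
    then have "k * (p choose k) = p * ((p - 1) choose (k - 1))" using binomial_absorption[of "k - 1" p] by simp
    then have "of_nat k * of_nat (p choose k) = P * of_nat ((p - 1) choose (k - 1))"
      by (simp flip: of_nat_mult)
    then show "of_nat (p choose k) = P * (inverse (of_nat k) * of_nat ((p - 1) choose (k - 1)))"
      using k by (simp add: field_simps)
  qed
  also have "cg 2 \<dots> (\<Sum>k=1..p-1. P * (inverse (of_nat k) * (- 1) ^ (k - 1)))"
    using unit_less by (intro cg_sum cg_P_mult_1 cg_mult_left binomial_pred_prime) auto
  also have "\<dots> = P * alt_harm (p - 1)"
    unfolding alt_harm_def sum_distrib_left
    by (intro sum.cong) (auto simp: power_diff mult_ac)
  finally show ?thesis .
qed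

text \<open>Under \<open>k\<close> to \<open>p - k\<close> the reciprocal changes sign modulo
  \<open>p\<close>, and so does the alternating sign because \<open>p\<close> is odd. The top
  \<open>n\<close> terms thus reproduce the first \<open>n\<close>.\<close>

lemma alt_harm_reflect:
  assumes "odd p" "n < p"
  shows "cg 1 (alt_harm (p - 1)) (alt_harm (p - 1 - n) + alt_harm n)"
  using \<open>n < p\<close>
proof (induction n)
  case 0
  have "alt_harm (p - 1) \<in> R" unfolding alt_harm_def
    by (intro R_sum R_mult R_power R_uminus R_numeral unit_less) auto
  then show ?case by (simp add: alt_harm_def cg_refl)
next
  case (Suc n)
  have "p - 1 - n = Suc (p - 1 - Suc n)" using Suc by simp
  then have 1: "alt_harm (p - 1 - n) = alt_harm (p - 1 - Suc n) + (- 1) ^ (p - 1 - Suc n) * inverse (of_nat (p - Suc n))"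
    using alt_harm_Suc[of "p - 1 - Suc n"] Suc.prems by simp
  have "(- 1) ^ (p - 1 - Suc n) = (- ((- 1) ^ n) :: rat)"
    using assms Suc.prems by (auto simp: uminus_power_if)
  have "alt_harm (p - 1 - Suc n) \<in> R" "alt_harm n \<in> R" unfolding alt_harm_def
    using Suc.prems by (auto intro!: R_sum R_mult R_power R_uminus R_numeral unit_less)
  have "cg 1 (alt_harm (p - 1)) (alt_harm (p - 1 - n) + alt_harm n)" using Suc by simp
  also have "cg 1 \<dots> (alt_harm (p - 1 - Suc n) + (- 1) ^ (p - 1 - Suc n) * (- inverse (of_nat (Suc n))) + alt_harm n)"
    unfolding 1 using Suc.prems \<open>alt_harm (p - 1 - Suc n) \<in> R\<close> \<open>alt_harm n \<in> R\<close>
    by (intro cg_add cg_refl cg_mult_left inverse_reflect R_power R_uminus R_numeral) auto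
  finally show ?case
    unfolding alt_harm_Suc \<open>(- 1) ^ (p - 1 - Suc n) = (- ((- 1) ^ n) :: rat)\<close> by (simp add: algebra_simps)
qed

text \<open>
  With \<open>N = p div 3\<close> we have \<open>(p - 1 - N) div 2 = N\<close>, so the first part of the reflected
  alternating sum is \<open>H (p - 1 - N) - H N\<close>, which vanishes modulo \<open>p\<close>.
\<close>

lemma fermat_quotient_2:
  assumes "p > 3" and N: "N = p div 3"
  shows "cg 2 (2 ^ (p - 1) - 1) (P / 2 * (H N - H (N div 2)))"
proof -
  have "odd p" using prime_p assms by (simp add: prime_odd_nat)
  have "p mod 3 \<noteq> 0" using primes_dvd_imp_eq[of 3 p] prime_p assms by (auto simp: dvd_eq_mod_eq_0)
  moreover have "p mod 3 < 3" "p = 3 * N + p mod 3" unfolding N by simp_all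
  ultimately have "p - 1 - N = 2 * N \<or> p - 1 - N = Suc (2 * N)" by linarith
  then have div: "(p - 1 - N) div 2 = N" by auto
  have "N < p" using assms by simp
  have R: "alt_harm N \<in> R" "H N \<in> R" using \<open>N < p\<close> unfolding alt_harm_def
    by (auto intro!: R_sum R_mult R_power R_uminus R_numeral unit_less)
  have "cg 1 (alt_harm (p - 1)) (alt_harm (p - 1 - N) + alt_harm N)"
    using \<open>odd p\<close> \<open>N < p\<close> by (rule alt_harm_reflect)
  also have "\<dots> = H (p - 1 - N) - H N + alt_harm N"
    using alt_harm_eq[of "p - 1 - N"] unfolding div by simp
  also have "cg 1 \<dots> (H N - H N + alt_harm N)"
    using \<open>N < p\<close> assms R by (intro cg_add cg_diff H_reflect cg_refl) auto
  finally have "cg 1 (alt_harm (p - 1)) (alt_harm N)" by simp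
  from cg_P_mult_1[OF this] two_power_alt_harm have "cg 2 (2 ^ p - 2) (P * alt_harm N)"
    using assms cg_trans by force
  then have 1: "cg 2 (inverse 2 * (2 ^ p - 2)) (inverse 2 * (P * alt_harm N))"
    using unit_less[of 2] assms by (intro cg_mult_left) auto
  have "(2::rat) ^ p = 2 * 2 ^ (p - 1)" using assms by (simp flip: power_Suc)
  have 2: "inverse 2 * (P * alt_harm N) = P / 2 * (H N - H (N div 2))"
    unfolding alt_harm_eq by (simp only: divide_inverse mult_ac)
  have 3: "inverse 2 * (2 ^ p - 2) = (2 ^ (p - 1) - 1 :: rat)"
    unfolding \<open>(2::rat) ^ p = 2 * 2 ^ (p - 1)\<close> by simp
  show ?thesis using 1 unfolding 2 3 .
qed

end

section \<open>The six congruences\<close>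

text \<open>The two numerator factors are exchanged. This lets the residue \<open>r = m - 1\<close>
  share the binomial identity of \<open>r = 1\<close>.\<close>

lemma leg_reflect: "leg (- 1 - x) k = leg x k"
  unfolding leg_def by (intro prod.cong arg_cong2[where f = "(/)"]) (auto simp: algebra_simps)

text \<open>The left side is \<open>(3k)! / (k!)^3\<close>, whose consecutive quotients
  \<open>(3k+1)(3k+2)(3k+3) / (k+1)^3\<close> are 27 times those of \<open>leg\<close>. The next two
  lemmas follow the same pattern.\<close>

lemma leg_third: "of_nat ((2 * k) choose k) * of_nat ((3 * k) choose k) = 27 ^ k * leg (- (1 / 3) :: rat) k"
proof -
  have "fact (3 * k) = (fact k) ^ 3 * 27 ^ k * leg (- (1 / 3) :: rat) k"
  proof (induction k)
    case (Suc k)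
    have "fact (3 * Suc k) = (of_nat (3 * k + 3) * of_nat (3 * k + 2) * of_nat (3 * k + 1) * fact (3 * k) :: rat)"
      by (simp add: eval_nat_numeral)
    then show ?case unfolding Suc
      by (simp add: leg_Suc divide_simps) (simp add: algebra_simps power2_eq_square power3_eq_cube)
  qed simp
  moreover have "of_nat ((2 * k) choose k) * of_nat ((3 * k) choose k) = (fact (3 * k) / (fact k) ^ 3 :: rat)"
    by (simp add: binomial_fact power3_eq_cube)
  ultimately show ?thesis by simp
qed

lemma leg_quarter: "of_nat ((2 * k) choose k) * of_nat ((4 * k) choose (2 * k)) = 64 ^ k * leg (- (1 / 4) :: rat) k"
proof -
  have "fact (4 * k) = (fact k)\<^sup>2 * fact (2 * k) * 64 ^ k * leg (- (1 / 4) :: rat) k"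
  proof (induction k)
    case (Suc k)
    have "fact (4 * Suc k) = (of_nat (4 * k + 4) * of_nat (4 * k + 3) * of_nat (4 * k + 2) * of_nat (4 * k + 1) * fact (4 * k) :: rat)"
      "fact (2 * Suc k) = (of_nat (2 * k + 2) * of_nat (2 * k + 1) * fact (2 * k) :: rat)"
      by (simp_all add: eval_nat_numeral)
    then show ?case unfolding Suc
      by (simp add: leg_Suc divide_simps) (simp add: algebra_simps power2_eq_square)
  qed simp
  moreover have "of_nat ((2 * k) choose k) * of_nat ((4 * k) choose (2 * k)) = (fact (4 * k) / ((fact k)\<^sup>2 * fact (2 * k)) :: rat)"
    by (simp add: binomial_fact power2_eq_square)
  ultimately show ?thesis by simp
qed

lemma leg_sixth: "of_nat ((3 * k) choose k) * of_nat ((6 * k) choose (3 * k)) = 432 ^ k * leg (- (1 / 6) :: rat) k"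
proof -
  have "fact (6 * k) = fact k * fact (2 * k) * fact (3 * k) * 432 ^ k * leg (- (1 / 6) :: rat) k"
  proof (induction k)
    case (Suc k)
    have "fact (6 * Suc k) = (of_nat (6 * k + 6) * of_nat (6 * k + 5) * of_nat (6 * k + 4) * of_nat (6 * k + 3) * of_nat (6 * k + 2) * of_nat (6 * k + 1) * fact (6 * k) :: rat)"
      "fact (3 * Suc k) = (of_nat (3 * k + 3) * of_nat (3 * k + 2) * of_nat (3 * k + 1) * fact (3 * k) :: rat)"
      "fact (2 * Suc k) = (of_nat (2 * k + 2) * of_nat (2 * k + 1) * fact (2 * k) :: rat)"
      by (simp_all add: eval_nat_numeral)
    then show ?case unfolding Suc
      by (simp add: leg_Suc divide_simps) (simp add: algebra_simps power2_eq_square)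
  qed simp
  moreover have "of_nat ((3 * k) choose k) * of_nat ((6 * k) choose (3 * k)) = (fact (6 * k) / (fact k * fact (2 * k) * fact (3 * k)) :: rat)"
    by (simp add: binomial_fact)
  ultimately show ?thesis by simp
qed

lemma prod_half_integers: "(\<Prod>j<n. of_nat j + 1 / 2 :: rat) = fact (2 * n) / (4 ^ n * fact n)"
proof (induction n)
  case (Suc n)
  have "fact (2 * Suc n) = (of_nat (2 * n + 2) * of_nat (2 * n + 1) * fact (2 * n) :: rat)"
    by (simp add: eval_nat_numeral)
  also have "\<dots> = 4 * (1 + of_nat n) * ((of_nat n + 1 / 2) * fact (2 * n))"
    by (simp add: field_simps)
  finally have f: "fact (2 * Suc n) = 4 * (1 + of_nat n) * ((of_nat n + 1 / 2) * fact (2 * n) :: rat)" .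
  have "fact (2 * n) / (4 ^ n * fact n) * (of_nat n + 1 / 2 :: rat)
      = 4 * (1 + of_nat n) * ((of_nat n + 1 / 2) * fact (2 * n)) / (4 * 4 ^ n * ((1 + of_nat n) * fact n))"
  proof -
    have "a / (b * d) * y = 4 * z * (y * a) / (4 * b * (z * d))" if "z \<noteq> 0" for a b d y z :: rat
      using that by simp
    from this[OF of_nat_plus_1_neq_0(2)] show ?thesis .
  qed
  then show ?case unfolding prod.lessThan_Suc Suc.IH f power_Suc fact_Suc[of n] of_nat_Suc .
qed simp

context prime_localization
begin

section \<open>Specialization to \<open>t = - (1 / m)\<close> and the single moduli\<close>

lemma scaled_sum:
  assumes "p > 2" "p = m * n + r" "r < m" "2 * n + 1 < p" "\<not> p dvd m" "\<not> p dvd m - 1" "m > 1"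
  shows "cg 2 (\<Sum>k=0..p-1. leg (- (of_nat r / of_nat m)) k / (of_nat m * of_nat k + (of_nat m - of_nat r)))
     ((of_nat m - 2) / (of_nat m * (of_nat m - 1)) *
       ((- 1) ^ n * (fact n / (\<Prod>i=n+1..2*n+1. of_nat i + P * (- (2 / of_nat m))))))"
proof -
  define t where "t = - inverse (of_nat m :: rat)"
  have m: "of_nat m \<noteq> (0::rat)" "of_nat m - 1 \<noteq> (0::rat)" "of_nat (m - 1) = (of_nat m - 1 :: rat)"
    using assms by (auto simp: of_nat_diff)
  have t1: "1 + t = (of_nat m - 1) / of_nat m" using m by (simp add: t_def field_simps)
  interpret shifted_residue p n t
  proof
    show "t \<in> R" unfolding t_def using assms by (intro R_uminus unit_of_nat)
    show "unit (1 + t)" unfolding t1 inverse_divide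
      using unit_of_nat[OF assms(6)] unfolding m(3) by (intro R_divide R_of_nat)
    show "1 + t \<noteq> 0" unfolding t1 using m by simp
  qed (use assms in auto)
  \<comment> \<open>From \<open>p = m * n + r\<close> one gets \<open>n - p / m = - r / m\<close>;
    adding 1 and scaling by \<open>m\<close> turns the shifted denominators into
    \<open>m * k + (m - r)\<close>.\<close>
  have a: "of_nat n + P * t = - (of_nat r / of_nat m)"
    unfolding t_def using m arg_cong[OF assms(2), of "of_nat :: nat \<Rightarrow> rat"] by (simp add: field_simps)
  have b: "of_nat k + (of_nat (Suc n) + P * t) = inverse (of_nat m) * (of_nat m * of_nat k + (of_nat m - of_nat r))" for k
    using a m by (simp add: field_simps)
  have "cg 2 (inverse (of_nat m) * F (of_nat n + P * t))
     (inverse (of_nat m) * ((1 + 2 * t) / (1 + t) * ((- 1) ^ n * fact n / (\<Prod>i=n+1..2*n+1. of_nat i + 2 * P * t))))"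
    using F_eq unit_of_nat[OF assms(5)] by (rule cg_mult_left[rotated])
  moreover have "inverse (of_nat m) * F (of_nat n + P * t)
      = (\<Sum>k=0..p-1. leg (- (of_nat r / of_nat m)) k / (of_nat m * of_nat k + (of_nat m - of_nat r)))"
    unfolding a b sum_distrib_left atLeast0AtMost
    by (intro sum.cong refl) (use m in \<open>simp add: field_simps\<close>)
  moreover have "inverse (of_nat m) * ((1 + 2 * t) / (1 + t)) = (of_nat m - 2) / (of_nat m * (of_nat m - 1))"
    unfolding t1 using m by (simp add: t_def field_simps)
  moreover have "2 * P * t = P * (- (2 / of_nat m))"
    by (simp add: t_def divide_inverse)
  moreover have "x * (y * (d * e / q)) = x * y * (d * (e / q))" for x y d e q :: rat by simp
  ultimately show ?thesis by (simp only:)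
qed

lemma small_fractions:
  assumes "p > 3"
  shows "1 / 2 \<in> R" "1 / 3 \<in> R" "2 / 3 \<in> R" "1 / 6 \<in> R"
proof -
  show *: "1 / 2 \<in> R" "1 / 3 \<in> R"
    using unit_less[of 2] unit_less[of 3] assms by (simp_all add: inverse_eq_divide)
  show "2 / 3 \<in> R" "1 / 6 \<in> R" using R_mult[OF R_numeral(1) *(2), of num.One]
    R_add[OF *(2) *(2)] R_mult[OF *] by simp_all
qed

lemma small_ndvd:
  assumes "p > 3"
  shows "\<not> p dvd 2" "\<not> p dvd 3" "\<not> p dvd 4"
proof -
  show "\<not> p dvd 2" "\<not> p dvd 3" using assms by (auto simp: nat_dvd_not_less)
  show "\<not> p dvd 4" using prime_p assms prime_dvd_mult_iff[of p 2 2] by (auto dest: dvd_imp_le)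
qed

lemma odd_p: "p > 3 \<Longrightarrow> odd p"
  by (intro prime_odd_nat prime_p) simp

lemma inverse_binomial: "1 / of_nat ((2 * n) choose n) = ((fact n)\<^sup>2 / fact (2 * n) :: rat)"
  by (simp add: binomial_fact power2_eq_square)

text \<open>For \<open>p = m * n + 1\<close> the split-off factor
  \<open>2 * n + 1 - 2 * p / m\<close> is the constant \<open>1 - 2 / m\<close>.\<close>

lemma prod_interval_last:
  fixes n :: nat
  shows "(\<Prod>i=n+1..2*n+1. f i :: rat) = (\<Prod>i=n+1..2*n. f i) * f (2 * n + 1)"
  by simp

lemma sum_mod_3_eq_1:
  assumes "p > 3" "p = 3 * n + 1"
  shows "cg 2 (\<Sum>k=0..p-1. of_nat ((2*k) choose k) * of_nat ((3*k) choose k) / (27 ^ k * (3 * of_nat k + 2)))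
    (1 / (2 * of_nat ((2 * n) choose n)))"
proof -
  \<comment> \<open>This makes the sign \<open>(- 1) ^ n\<close> equal to 1.\<close>
  have "even n" using odd_p assms by auto
  let ?Q = "\<Prod>i=n+1..2*n. of_nat i + P * (- (2 / 3))"
  have "cg 2 (\<Sum>k=0..p-1. leg (- (1 / 3)) k / (3 * of_nat k + 2))
     (1 / 6 * (fact n / (\<Prod>i=n+1..2*n+1. of_nat i + P * (- (2 / 3)))))"
    using scaled_sum[of 3 n 1] assms small_ndvd \<open>even n\<close> by simp
  also have "(\<Prod>i=n+1..2*n+1. of_nat i + P * (- (2 / 3))) = ?Q * (1 / 3)"
    unfolding prod_interval_last by (simp add: assms(2) field_simps)
  also have "1 / 6 * (fact n / (?Q * (1 / 3))) = 1 / 2 * (fact n / ?Q)" by simp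
  also have "cg 2 \<dots> (1 / 2 * ((fact n)\<^sup>2 / fact (2 * n)))"
    using assms small_fractions by (intro cg_mult_left inverse_prod_shift_reflect R_uminus) auto
  finally show ?thesis unfolding inverse_binomial[symmetric] by (simp add: leg_third)
qed

text \<open>Here the reflected product extends to \<open>2 * n + 1\<close>. Splitting
  \<open>2 * n + 1 = (2 * p - 1) / 3\<close> off the factorial produces
  \<open>1 / (1 - 2 * p)\<close>, which is \<open>1 + 2 * p\<close> modulo
  \<open>p^2\<close>.\<close>

lemma sum_mod_3_eq_2:
  assumes "p > 3" "p = 3 * n + 2"
  shows "cg 2 (\<Sum>k=0..p-1. of_nat ((2*k) choose k) * of_nat ((3*k) choose k) / (27 ^ k * (3 * of_nat k + 1)))
    ((1 + 2 * P) / (2 * of_nat ((2 * n) choose n)))"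
proof -
  have "odd n" using odd_p assms by auto
  have leg: "leg (- (2 / 3) :: rat) k = leg (- (1 / 3)) k" for k
    using leg_reflect[of "- (1 / 3) :: rat" k] by simp
  let ?C = "(fact n)\<^sup>2 / fact (2 * n) :: rat"
  have "cg 2 (\<Sum>k=0..p-1. leg (- (1 / 3)) k / (3 * of_nat k + 1))
     (- (1 / 6) * (fact n / (\<Prod>i=n+1..2*n+1. of_nat i + P * (- (2 / 3)))))"
    using scaled_sum[of 3 n 2] assms small_ndvd \<open>odd n\<close> by (simp add: leg)
  also have "cg 2 \<dots> (- (1 / 6) * ((fact n)\<^sup>2 / fact (2 * n + 1)))"
    using assms small_fractions by (intro cg_mult_left inverse_prod_shift_reflect R_uminus) auto
  also have "- (1 / 6) * ((fact n)\<^sup>2 / fact (2 * n + 1)) = 1 / 2 * ?C * inverse (1 + P * (- 2))"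
  proof -
    have "1 + P * (- 2) = - 3 * (1 + 2 * of_nat n)" by (simp add: assms(2))
    then show ?thesis by (simp only: inverse_mult_distrib) (simp add: field_simps)
  qed
  also have "cg 2 \<dots> (1 / 2 * ?C * (1 + 2 * P))"
  proof (rule cg_mult_left)
    show "1 / 2 * ?C \<in> R"
      using assms by (intro R_mult[OF small_fractions(1)] R_divide R_power R_fact unit_fact) auto
    show "cg 2 (inverse (1 + P * (- 2))) (1 + 2 * P)"
      using cg_inverse_shift(2)[of 1 "-2"] R_uminus[OF R_numeral(1)] R_numeral(3) by (simp add: mult.commute)
  qed
  finally show ?thesis unfolding inverse_binomial[symmetric] by (simp add: leg_third)
qed

lemma prod_half_integers_interval:
  "(\<Prod>i=n+1..q. of_nat i - (of_nat q + 1 / 2) :: rat) = (- 1) ^ (q - n) * (fact (2 * (q - n)) / (4 ^ (q - n) * fact (q - n)))"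
proof -
  have "(\<Prod>i=n+1..q. of_nat i - (of_nat q + 1 / 2) :: rat) = (\<Prod>j<q-n. - 1 * (of_nat j + 1 / 2))"
    by (rule prod.reindex_bij_witness[of _ "\<lambda>j. q - j" "\<lambda>i. q - i"]) (auto simp: of_nat_diff)
  then show ?thesis unfolding prod.distrib prod_half_integers by simp
qed

text \<open>
  For \<open>m = 4\<close> the product in \<open>scaled_sum\<close> runs over half integers, so it is known exactly. Comparing it
  with \<open>prod_shift_1\<close> gives \<open>2 ^ ((p - 1) / 2) = \<plusminus>1 + p * c\<close>, and the difference of the two sides of the
  congruence turns out to be a multiple of the square of \<open>p * c\<close>.
\<close>

lemma sum_mod_4_eq_1:
  assumes "p > 3" "p = 4 * n + 1"
  shows "cg 2 (\<Sum>k=0..p-1. of_nat ((2*k) choose k) * of_nat ((4*k) choose (2*k)) / (64 ^ k * (4 * of_nat k + 3)))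
    ((- 1) ^ n * ((2 ^ (p - 1) + 1) / (6 * of_nat ((2 * n) choose n))))"
proof -
  define Q where "Q = (\<Prod>i=n+1..2*n+1. of_nat i + P * (- (1 / 2)))"
  define e :: rat where "e = (- 1) ^ n"
  \<comment> \<open>\<open>x\<close> is \<open>2 ^ ((p - 1) / 2)\<close>, since
    \<open>(p - 1) / 2 = 2 * n\<close>; \<open>e\<close> is the sign to which it is congruent modulo
    \<open>p\<close>.\<close>
  define x :: rat where "x = 4 ^ n"
  let ?C = "(fact n)\<^sup>2 / fact (2 * n) :: rat"
  have e: "e * e = 1" "e \<in> R" "e \<noteq> 0"
    unfolding e_def by (auto intro: R_power R_uminus R_numeral simp flip: power_mult_distrib)
  have x: "x \<in> R" "x \<noteq> 0" unfolding x_def by (auto intro: R_power R_numeral)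
  have half: "1 / 2 \<in> R" using assms by (intro small_fractions)
  have Q: "Q = e * (fact (2 * n) / (x * fact n)) * (1 / 2)"
  proof -
    have "of_nat i + P * (- (1 / 2)) = of_nat i - (of_nat (2 * n) + 1 / 2)" for i
      by (simp add: assms(2) field_simps)
    then show ?thesis
      unfolding Q_def prod_interval_last e_def x_def by (simp only: prod_half_integers_interval) simp
  qed
  have main: "cg 2 (\<Sum>k=0..p-1. leg (- (1 / 4)) k / (4 * of_nat k + 3)) (1 / 6 * (e * (fact n / Q)))"
    unfolding Q_def e_def using scaled_sum[of 4 n 1] assms small_ndvd by simp
  have "cg 1 Q (fact (2 * n + 1) / fact n)"
    unfolding Q_def using assms half by (intro prod_shift_1 R_uminus) auto
  then have "cg 1 (e * x * 2 * fact n * inverse (fact (2 * n)) * Q)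
      (e * x * 2 * fact n * inverse (fact (2 * n)) * (fact (2 * n + 1) / fact n))"
    using e x assms by (intro cg_mult_left R_mult R_fact R_numeral unit_fact) auto
  also have "e * x * 2 * fact n * inverse (fact (2 * n)) * Q = 1"
    unfolding Q using e x by (simp add: field_simps)
  also have "e * x * 2 * fact n * inverse (fact (2 * n)) * (fact (2 * n + 1) / fact n) = e * x * (1 + P)"
    by (simp add: assms(2) field_simps)
  finally obtain d where d: "d \<in> R" "1 = e * x * (1 + P) + P ^ 1 * d" by (elim cgE)
  have "x = e + P * (- (e * d + x))" using d(2) e(1) by Groebner_Basis.algebra
  then obtain c where c: "c \<in> R" "x = e + P * c" 
    using d e x by (metis R_add R_mult R_uminus)
  have "(2::rat) ^ (p - 1) = x\<^sup>2"
  proof -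
    have "(2::rat) ^ (p - 1) = 2 ^ (2 * (n * 2))" using assms by (simp add: mult.commute)
    then show ?thesis unfolding power_mult x_def by simp
  qed
  have "1 / 6 * (e * (fact n / Q)) = 1 / 6 * ?C * (2 * x)"
    unfolding Q using e x by (simp add: power2_eq_square)
  also have "cg 2 \<dots> (1 / 6 * ?C * (e * (2 ^ (p - 1) + 1)))"
  proof (rule cg_mult_left)
    show "1 / 6 * ?C \<in> R"
      using assms by (intro R_mult[OF small_fractions(4)] R_divide R_power R_fact unit_fact) auto
    show "cg 2 (2 * x) (e * (2 ^ (p - 1) + 1))"
    proof (rule cgI')
      \<comment> \<open>Completing the square with \<open>e * e = 1\<close>:
        \<open>2 * x - e * (x^2 + 1) = - e * (x - e)^2\<close>, and
        \<open>x - e = P * c\<close>.\<close>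
      show "2 * x = e * (2 ^ (p - 1) + 1) + P\<^sup>2 * (- (e * c\<^sup>2))"
        unfolding \<open>(2::rat) ^ (p - 1) = x\<^sup>2\<close> c(2) using e(1) by Groebner_Basis.algebra
    qed (use c e x in \<open>auto intro!: R_mult R_add R_power R_numeral R_uminus\<close>)
  qed
  finally have "cg 2 (1 / 6 * (e * (fact n / Q))) (1 / 6 * ?C * (e * (2 ^ (p - 1) + 1)))" .
  from cg_trans[OF main this] show ?thesis
    unfolding inverse_binomial[symmetric] e_def[symmetric] by (simp add: leg_quarter)
qed

text \<open>Again \<open>x = 2 ^ ((p - 1) / 2)\<close>, now congruent to \<open>- e\<close>. The
  factor \<open>2 * n + 1 = (p - 1) / 2\<close> of the factorial brings in
  \<open>w = 1 / (1 - p)\<close>, which accounts for the extra \<open>2 * P\<close>.\<close>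

lemma sum_mod_4_eq_3:
  assumes "p > 3" "p = 4 * n + 3"
  shows "cg 2 (\<Sum>k=0..p-1. of_nat ((2*k) choose k) * of_nat ((4*k) choose (2*k)) / (64 ^ k * (4 * of_nat k + 1)))
    ((- 1) ^ (n + 1) * ((2 ^ (p - 1) + 2 * P + 1) / (6 * of_nat ((2 * n) choose n))))"
proof -
  define Q where "Q = (\<Prod>i=n+1..2*n+1. of_nat i + P * (- (1 / 2)))"
  define e :: rat where "e = (- 1) ^ n"
  define x :: rat where "x = 2 * 4 ^ n"
  let ?C = "(fact n)\<^sup>2 / fact (2 * n) :: rat"
  have e: "e * e = 1" "e \<in> R" "e \<noteq> 0"
    unfolding e_def by (auto intro: R_power R_uminus R_numeral simp flip: power_mult_distrib)
  have x: "x \<in> R" "x \<noteq> 0" unfolding x_def by (auto intro: R_mult R_power R_numeral)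
  have half: "1 / 2 \<in> R" using assms by (intro small_fractions)
  have leg: "leg (- (3 / 4) :: rat) k = leg (- (1 / 4)) k" for k
    using leg_reflect[of "- (1 / 4) :: rat" k] by simp
  have Q: "Q = - (e * (fact (2 * n + 1) / (x * fact n)))"
  proof -
    have "of_nat i + P * (- (1 / 2)) = of_nat i - (of_nat (2 * n + 1) + 1 / 2)" for i
      by (simp add: assms(2) field_simps)
    moreover have cancel: "(- 1) ^ (n + 1) * (2 * s * y / (4 ^ (n + 1) * (s * z))) = - (e * (y / (x * z)))"
      if "s \<noteq> 0" for s y z using that by (simp add: e_def x_def)
    ultimately have "Q = (- 1) ^ (n + 1) * (fact (2 * (n + 1)) / (4 ^ (n + 1) * fact (n + 1)))"
      unfolding Q_def by (simp only: prod_half_integers_interval) simp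
    also have "(fact (2 * (n + 1)) :: rat) = 2 * of_nat (n + 1) * fact (2 * n + 1)" by simp
    also have "(fact (n + 1) :: rat) = of_nat (n + 1) * fact n" by simp
    also have "(- 1) ^ (n + 1) * (2 * of_nat (n + 1) * fact (2 * n + 1) / (4 ^ (n + 1) * (of_nat (n + 1) * fact n)))
      = - (e * (fact (2 * n + 1) / (x * fact n)))" by (rule cancel) simp
    finally show ?thesis .
  qed
  have main: "cg 2 (\<Sum>k=0..p-1. leg (- (1 / 4)) k / (4 * of_nat k + 1)) (1 / 6 * (e * (fact n / Q)))"
    unfolding Q_def e_def using scaled_sum[of 4 n 3] assms small_ndvd by (simp add: leg)
  have "cg 1 Q (fact (2 * n + 1) / fact n)"
    unfolding Q_def using assms half by (intro prod_shift_1 R_uminus) auto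
  then have "cg 1 (- e * x * fact n * inverse (fact (2 * n + 1)) * Q)
      (- e * x * fact n * inverse (fact (2 * n + 1)) * (fact (2 * n + 1) / fact n))"
    using e x assms by (intro cg_mult_left R_mult R_fact R_uminus unit_fact) auto
  also have "- e * x * fact n * inverse (fact (2 * n + 1)) * Q = 1"
    unfolding Q using e x by (simp add: field_simps del: fact_Suc)
  also have "- e * x * fact n * inverse (fact (2 * n + 1)) * (fact (2 * n + 1) / fact n) = - (e * x)"
    by (simp del: fact_Suc)
  finally obtain d where d: "d \<in> R" "1 = - (e * x) + P ^ 1 * d" by (elim cgE)
  define c where "c = e * d"
  have c: "c \<in> R" "x = - e + P * c"
    unfolding c_def using d e by (auto intro: R_mult) Groebner_Basis.algebra
  have "(2::rat) ^ (p - 1) = x\<^sup>2"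
  proof -
    have "(2::rat) ^ (p - 1) = 2 ^ (2 * (n * 2)) * 2\<^sup>2"
      using assms by (simp add: mult.commute flip: power_add)
    then show ?thesis unfolding power_mult x_def by (simp add: power_mult_distrib)
  qed
  define w where "w = inverse (1 + P * (- 1))"
  have w: "w \<in> R" "w * (1 + P * (- 1)) = 1"
    unfolding w_def using unit_add_multiple[of 1 "-1"] R_uminus[OF R_numeral(3)] R_numeral(3) by auto
  have "1 / 6 * (e * (fact n / Q)) = 1 / 6 * ?C * (2 * x * w)"
  proof -
    have "1 + P * (- 1) = - 2 * (2 * of_nat n + 1)" by (simp add: assms(2))
    then have w_eq: "w = - inverse (2 * (2 * of_nat n + 1))" unfolding w_def by (simp only: inverse_mult_distrib) simp
    have f: "fact (2 * n + 1) = (2 * of_nat n + 1) * (fact (2 * n) :: rat)" by (simp add: add.commute)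
    have z: "2 * of_nat n + 1 \<noteq> (0::rat)" using of_nat_plus_1_neq_0(1)[of "2 * n", where ?'a = rat] by simp
    have "1 / 6 * (e * (y / (- (e * (z * g / (x * y)))))) = 1 / 6 * (y\<^sup>2 / g) * (2 * x * (- inverse (2 * z)))"
      if "z \<noteq> 0" "g \<noteq> 0" for y z g using that e x by (simp add: power2_eq_square field_simps)
    from this[OF z fact_nonzero] show ?thesis unfolding Q f w_eq .
  qed
  also have "cg 2 \<dots> (1 / 6 * ?C * (- e * (2 ^ (p - 1) + 2 * P + 1)))"
  proof (rule cg_mult_left)
    show "1 / 6 * ?C \<in> R"
      using assms by (intro R_mult[OF small_fractions(4)] R_divide R_power R_fact unit_fact) auto
    show "cg 2 (2 * x * w) (- e * (2 ^ (p - 1) + 2 * P + 1))"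
    proof (rule cgI')
      show "2 * x * w = - e * (2 ^ (p - 1) + 2 * P + 1) + P\<^sup>2 * (e * c\<^sup>2 + 2 * c + 2 * x * w)"
        unfolding \<open>(2::rat) ^ (p - 1) = x\<^sup>2\<close> using c(2) e(1) w(2) by Groebner_Basis.algebra
      show "- e * (2 ^ (p - 1) + 2 * P + 1) \<in> R"
        using e by (intro R_mult R_add R_power R_numeral R_uminus R_of_nat)
      show "e * c\<^sup>2 + 2 * c + 2 * x * w \<in> R"
        using c(1) e(2) x(1) w(1) by (intro R_mult R_add R_power R_numeral)
    qed
  qed
  finally have "cg 2 (1 / 6 * (e * (fact n / Q))) (1 / 6 * ?C * (- e * (2 ^ (p - 1) + 2 * P + 1)))" .
  moreover have "(- 1) ^ (n + 1) = - e" by (simp add: e_def)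
  ultimately show ?thesis
    using cg_trans[OF main] unfolding inverse_binomial[symmetric] by (simp add: leg_quarter)
qed

text \<open>
  For \<open>m = 6\<close> the binomial coefficient on the right-hand side is, up to sign, a product over \<open>i - p\<close>,
  so that both sides are instances of \<open>inverse_prod_shift\<close>.
\<close>

lemma binomial_eq_prod_shift:
  assumes "m < p"
  shows "of_nat ((p - 1 - m) choose k) = (- 1) ^ k * (\<Prod>i=m+1..m+k. of_nat i + P * (- 1)) / fact k"
proof -
  have "of_nat (p - 1 - m) = P - 1 - of_nat m" using assms by (simp add: of_nat_diff)
  then have "of_nat ((p - 1 - m) choose k) = (\<Prod>i=0..<k. P - 1 - of_nat m - of_nat i) / fact k"
    unfolding binomial_gbinomial gbinomial_prod_rev by simp
  also have "(\<Prod>i=0..<k. P - 1 - of_nat m - of_nat i) = (\<Prod>i=m+1..m+k. (- 1) * (of_nat i + P * (- 1)))"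
    by (rule prod.reindex_bij_witness[of _ "\<lambda>i. i - m - 1" "\<lambda>i. i + m + 1"]) auto
  finally show ?thesis unfolding prod.distrib by simp
qed

text \<open>The sum leads to the shift \<open>s = - 1 / 3\<close>, the binomial coefficient to
  \<open>s = - 1\<close>. The linear factors \<open>1 + P * D / 3\<close> and
  \<open>1 + P * D\<close> differ by \<open>1 - 2 / 3 * P * D\<close>, and \<open>P / 2 * D\<close>
  is the Fermat term \<open>T\<close> modulo \<open>p^2\<close>.\<close>

lemma sum_mod_6_eq_1:
  assumes "p > 3" "p = 6 * n + 1"
  shows "cg 2 (\<Sum>k=0..p-1. of_nat ((3*k) choose k) * of_nat ((6*k) choose (3*k)) / (432 ^ k * (6 * of_nat k + 5)))
    ((1 - 4 / 3 * (2 ^ (p - 1) - 1)) / (5 * of_nat ((5 * n) choose n)))"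
proof -
  define D where "D = H (2 * n) - H n"
  define e :: rat where "e = (- 1) ^ n"
  define B :: rat where "B = (fact n)\<^sup>2 / fact (2 * n)"
  define T :: rat where "T = 2 ^ (p - 1) - 1"
  let ?Q = "\<lambda>s. fact n / (\<Prod>i=n+1..2*n. of_nat i + P * s)"
  have "p > 6" using assms by (cases n) auto
  then have ndvd: "\<not> p dvd 5" "\<not> p dvd 6" by (auto dest!: dvd_imp_le)
  have R: "1 / 5 \<in> R" "1 / 3 \<in> R" "4 / 3 \<in> R" "e \<in> R" "B \<in> R" "D \<in> R"
  proof -
    show "1 / 5 \<in> R" using unit_of_nat[OF ndvd(1)] by (simp add: inverse_eq_divide)
    show *: "1 / 3 \<in> R" using assms by (intro small_fractions)
    show "4 / 3 \<in> R" using R_add[OF R_numeral(3) *] by simp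
    show "e \<in> R" unfolding e_def by (intro R_power R_uminus R_numeral)
    show "B \<in> R" unfolding B_def using assms by (intro R_divide R_power R_fact unit_fact) auto
    show "D \<in> R" unfolding D_def using assms by (intro R_diff R_H) auto
  qed
  have Q: "cg 2 (?Q s) (B * (1 - P * s * D))" if "s \<in> R" for s
    unfolding B_def D_def using that assms by (intro inverse_prod_shift) auto
  have T: "cg 2 T (P / 2 * D)"
  proof -
    have "2 * n = p div 3" "2 * n div 2 = n" using assms by simp_all
    then show ?thesis using fermat_quotient_2[of "2 * n"] assms(1) unfolding T_def D_def by (simp only:)
  qed
  have TR: "P / 2 * D \<in> R" using T by (rule cgE)
  have E: "e * ?Q (- 1) = 1 / of_nat ((5 * n) choose n)"
  proof -
    have "p - 1 - n = 5 * n" "n + n = 2 * n" "n < p" using assms by simp_all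
    then have "of_nat ((5 * n) choose n) = e * (\<Prod>i=n+1..2*n. of_nat i + P * (- 1)) / fact n"
      using binomial_eq_prod_shift[of n n] unfolding e_def by (simp only:)
    moreover have "e * (y / z) = 1 / (e * z / y)" for y z
      using minus_one_power_iff[of n, where ?'a = rat] by (simp add: e_def)
    ultimately show ?thesis by (simp only:)
  qed
  have "cg 2 (\<Sum>k=0..p-1. leg (- (1 / 6)) k / (6 * of_nat k + 5))
      (2 / 15 * (e * (fact n / (\<Prod>i=n+1..2*n+1. of_nat i + P * (- (1 / 3))))))"
    unfolding e_def using scaled_sum[of 6 n 1] assms ndvd by simp
  also have "(\<Prod>i=n+1..2*n+1. of_nat i + P * (- (1 / 3))) = (\<Prod>i=n+1..2*n. of_nat i + P * (- (1 / 3))) * (2 / 3)"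
    unfolding prod_interval_last by (simp add: assms(2) field_simps)
  also have "2 / 15 * (e * (fact n / ((\<Prod>i=n+1..2*n. of_nat i + P * (- (1 / 3))) * (2 / 3)))) = 1 / 5 * (e * ?Q (- (1 / 3)))"
    by simp
  also have "cg 2 \<dots> (1 / 5 * (e * (B * (1 - P * (- (1 / 3)) * D))))"
    using R by (intro cg_mult_left Q R_uminus)
  also have "cg 2 \<dots> (1 / 5 * (e * ((1 - 4 / 3 * (P / 2 * D)) * (B * (1 - P * (- 1) * D)))))"
  proof (rule cgI')
    show "1 / 5 * (e * (B * (1 - P * (- (1 / 3)) * D))) =
        1 / 5 * (e * ((1 - 4 / 3 * (P / 2 * D)) * (B * (1 - P * (- 1) * D)))) + P\<^sup>2 * (1 / 5 * (e * (B * (D\<^sup>2 * (1 / 3 + 1 / 3)))))"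
      by (simp add: field_simps power2_eq_square)
    show "1 / 5 * (e * ((1 - 4 / 3 * (P / 2 * D)) * (B * (1 - P * (- 1) * D)))) \<in> R"
      by (intro R_mult[OF R(1)] R_mult[OF R(4)] R_mult[OF _ R_mult[OF R(5)]] R_diff R_mult[OF R(3) TR]
          R_mult[OF R_mult[OF R_of_nat] R(6)] R_numeral R_uminus)
  qed (use R in \<open>intro R_mult R_add R_power\<close>)
  also have "cg 2 \<dots> (1 / 5 * (e * ((1 - 4 / 3 * T) * ?Q (- 1))))"
    by (rule cg_sym, intro cg_mult_left cg_mult cg_diff cg_refl R_numeral T Q R_uminus R)
  also have "1 / 5 * (e * ((1 - 4 / 3 * T) * ?Q (- 1))) = 1 / 5 * ((1 - 4 / 3 * T) * (e * ?Q (- 1)))"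
    by (simp only: mult_ac)
  also have "\<dots> = (1 - 4 / 3 * T) / (5 * of_nat ((5 * n) choose n))"
    unfolding E by simp
  finally show ?thesis unfolding T_def by (simp add: leg_sixth)
qed

text \<open>The binomial coefficient covers only the factors from \<open>n + 2\<close> on, so
  \<open>n + 1 - P = c - P = (1 - 5 * P) / 6\<close> is split off. Multiplied by
  \<open>1 + 5 * P\<close> it becomes \<open>1 / 6\<close> modulo \<open>p^2\<close>, which turns
  \<open>4 / 5\<close> into \<open>2 / 15\<close>.\<close>

lemma sum_mod_6_eq_5:
  assumes "p > 5" "p = 6 * n + 5"
  shows "cg 2 (\<Sum>k=0..p-1. of_nat ((3*k) choose k) * of_nat ((6*k) choose (3*k)) / (432 ^ k * (6 * of_nat k + 1)))
    (4 / 5 * ((1 + 5 * P - 4 / 3 * (2 ^ (p - 1) - 1)) / of_nat ((5 * n + 3) choose n)))"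
proof -
  define D where "D = H (2 * n + 1) - H n"
  define e :: rat where "e = (- 1) ^ n"
  define B :: rat where "B = (fact n)\<^sup>2 / fact (2 * n + 1)"
  define T :: rat where "T = 2 ^ (p - 1) - 1"
  define c :: rat where "c = (P + 1) / 6"
  let ?Q = "\<lambda>s. fact n / (\<Prod>i=n+1..2*n+1. of_nat i + P * s)"
  have c: "c = of_nat (n + 1)" unfolding c_def by (simp add: assms(2))
  have leg: "leg (- (5 / 6) :: rat) k = leg (- (1 / 6)) k" for k
    using leg_reflect[of "- (1 / 6) :: rat" k] by simp
  have ndvd: "\<not> p dvd 5" "\<not> p dvd 6"
    using assms by (auto dest!: dvd_imp_le)
  have R: "2 / 15 \<in> R" "4 / 5 \<in> R" "1 / 3 \<in> R" "4 / 3 \<in> R" "10 / 3 \<in> R" "2 / 3 \<in> R" "e \<in> R" "B \<in> R" "D \<in> R" "c \<in> R"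
  proof -
    have 5: "1 / 5 \<in> R" using unit_of_nat[OF ndvd(1)] by (simp add: inverse_eq_divide)
    show 3: "1 / 3 \<in> R" "2 / 3 \<in> R" using assms by (intro small_fractions; simp)+
    show "4 / 3 \<in> R" "10 / 3 \<in> R" "2 / 15 \<in> R" "4 / 5 \<in> R"
      using R_mult[OF R_numeral(1)[of "num.Bit0 (num.Bit0 num.One)"] 3(1)] R_mult[OF R_numeral(1)[of "num.Bit0 (num.Bit1 (num.Bit0 num.One))"] 3(1)]
        R_mult[OF 5 3(2)] R_mult[OF R_numeral(1)[of "num.Bit0 (num.Bit0 num.One)"] 5] by simp_all
    show "e \<in> R" unfolding e_def by (intro R_power R_uminus R_numeral)
    show "B \<in> R" unfolding B_def using assms by (intro R_divide R_power R_fact unit_fact) auto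
    show "D \<in> R" unfolding D_def using assms by (intro R_diff R_H) auto
    show "c \<in> R" unfolding c by (rule R_of_nat)
  qed
  have Q: "cg 2 (?Q s) (B * (1 - P * s * D))" if "s \<in> R" for s
    unfolding B_def D_def using that assms by (intro inverse_prod_shift) auto
  have T: "cg 2 T (P / 2 * D)"
  proof -
    have "2 * n + 1 = p div 3" "(2 * n + 1) div 2 = n" using assms by simp_all
    then show ?thesis using fermat_quotient_2[of "2 * n + 1"] assms(1) unfolding T_def D_def by (simp only:)
  qed
  have TR: "P / 2 * D \<in> R" using T by (rule cgE)
  have "cg 2 (\<Sum>k=0..p-1. leg (- (1 / 6)) k / (6 * of_nat k + 1)) (2 / 15 * (e * ?Q (- (1 / 3))))"
    unfolding e_def using scaled_sum[of 6 n 5] assms ndvd by (simp add: leg)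
  also have "cg 2 \<dots> (2 / 15 * (e * (B * (1 - P * (- (1 / 3)) * D))))"
    using R by (intro cg_mult_left Q R_uminus)
  also have "cg 2 \<dots> (4 / 5 * (e * ((1 + 5 * P - 4 / 3 * (P / 2 * D)) * ((c - P) * (B * (1 - P * (- 1) * D))))))"
  proof (rule cgI')
    show "2 / 15 * (e * (B * (1 - P * (- (1 / 3)) * D))) =
        4 / 5 * (e * ((1 + 5 * P - 4 / 3 * (P / 2 * D)) * ((c - P) * (B * (1 - P * (- 1) * D)))))
        + P\<^sup>2 * (2 / 15 * (e * (B * (25 - 10 / 3 * D + 25 * P * D + 2 / 3 * D\<^sup>2 - 10 / 3 * P * D\<^sup>2))))"
      unfolding c_def by (simp add: field_simps power2_eq_square)
    show "4 / 5 * (e * ((1 + 5 * P - 4 / 3 * (P / 2 * D)) * ((c - P) * (B * (1 - P * (- 1) * D))))) \<in> R"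
      by (intro R_mult[OF R(2)] R_mult[OF R(7)] R_mult[OF _ R_mult[OF _ R_mult[OF R(8)]]] R_diff R_add R_mult[OF R(4) TR]
          R_mult[OF R_mult[OF R_of_nat] R(9)] R_mult[OF R_numeral(1) R_of_nat] R_numeral R_uminus R_of_nat R(10))
    show "2 / 15 * (e * (B * (25 - 10 / 3 * D + 25 * P * D + 2 / 3 * D\<^sup>2 - 10 / 3 * P * D\<^sup>2))) \<in> R"
      using R by (intro R_mult R_add R_diff R_power R_numeral R_of_nat)
  qed
  also have "cg 2 \<dots> (4 / 5 * (e * ((1 + 5 * P - 4 / 3 * T) * ((c - P) * ?Q (- 1)))))"
    by (rule cg_sym, intro cg_mult_left cg_mult cg_diff cg_refl R_numeral R_add R_mult[OF R_numeral(1) R_of_nat] R_of_nat T Q R_uminus R)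
  also have "\<dots> = 4 / 5 * ((1 + 5 * P - 4 / 3 * T) / of_nat ((5 * n + 3) choose n))"
  proof -
    let ?Q' = "\<Prod>i=n+2..2*n+1. of_nat i + P * (- 1)"
    have "p - 1 - (n + 1) = 5 * n + 3" "n + 1 + n = 2 * n + 1" "n + 1 + 1 = n + 2" "n + 1 < p" using assms by simp_all
    then have C: "of_nat ((5 * n + 3) choose n) = e * ?Q' / fact n"
      using binomial_eq_prod_shift[of "n + 1" n] unfolding e_def by (simp only:)
    have "y / (e * q / z) = e * (y * (d * (z / (d * q))))" if "d \<noteq> 0" for y z d q
      using minus_one_power_iff[of n, where ?'a = rat] that by (simp add: e_def)
    moreover have "{n+1..2*n+1} = insert (n + 1) {n+2..2*n+1}" by auto
    then have "(\<Prod>i=n+1..2*n+1. of_nat i + P * (- 1)) = (c - P) * ?Q'" unfolding c by simp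
    moreover have "c - P \<noteq> 0"
    proof -
      have "c - P = - of_nat (5 * n + 4)" unfolding c by (simp add: assms(2))
      then show ?thesis by (simp del: of_nat_add of_nat_mult)
    qed
    ultimately show ?thesis unfolding C by (simp only:)
  qed
  finally show ?thesis unfolding T_def by (simp add: leg_sixth)
qed

end

theorem theorem2p3:
  fixes p :: nat
  assumes "prime p" and "p > 3"
  shows "([p = 1] (mod 3) \<longrightarrow>
      cong_loc p
        (\<Sum>k = 0..p - 1. of_nat ((2*k) choose k) * of_nat ((3*k) choose k) / (27 ^ k * (3 * of_nat k + 2)))
        (1 / (2 * of_nat ((2 * (p - 1) div 3) choose ((p - 1) div 3))))
        (of_nat p ^ 2)) \<and>
    ([p = 2] (mod 3) \<longrightarrow>
      cong_loc p
        (\<Sum>k = 0..p - 1. of_nat ((2*k) choose k) * of_nat ((3*k) choose k) / (27 ^ k * (3 * of_nat k + 1)))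
        ((1 + 2 * of_nat p) / (2 * of_nat ((2 * (p - 2) div 3) choose ((p - 2) div 3))))
        (of_nat p ^ 2)) \<and>
    ([p = 1] (mod 4) \<longrightarrow>
      cong_loc p
        (\<Sum>k = 0..p - 1. of_nat ((2*k) choose k) * of_nat ((4*k) choose (2*k)) / (64 ^ k * (4 * of_nat k + 3)))
        ((- 1) ^ ((p - 1) div 4) * ((2 ^ (p - 1) + 1) / (6 * of_nat (((p - 1) div 2) choose ((p - 1) div 4)))))
        (of_nat p ^ 2)) \<and>
    ([p = 3] (mod 4) \<longrightarrow>
      cong_loc p
        (\<Sum>k = 0..p - 1. of_nat ((2*k) choose k) * of_nat ((4*k) choose (2*k)) / (64 ^ k * (4 * of_nat k + 1)))
        ((- 1) ^ ((p + 1) div 4) *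
          ((2 ^ (p - 1) + 2 * of_nat p + 1) / (6 * of_nat (((p - 3) div 2) choose ((p - 3) div 4)))))
        (of_nat p ^ 2)) \<and>
    ([p = 1] (mod 6) \<longrightarrow>
      cong_loc p
        (\<Sum>k = 0..p - 1. of_nat ((3*k) choose k) * of_nat ((6*k) choose (3*k)) / (432 ^ k * (6 * of_nat k + 5)))
        ((1 - 4 / 3 * (2 ^ (p - 1) - 1)) / (5 * of_nat ((5 * (p - 1) div 6) choose ((p - 1) div 6))))
        (of_nat p ^ 2)) \<and>
    ([p = 5] (mod 6) \<and> p \<noteq> 5 \<longrightarrow>
      cong_loc p
        (\<Sum>k = 0..p - 1. of_nat ((3*k) choose k) * of_nat ((6*k) choose (3*k)) / (432 ^ k * (6 * of_nat k + 1)))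
        (4 / 5 * ((1 + 5 * of_nat p - 4 / 3 * (2 ^ (p - 1) - 1)) /
          of_nat (((5 * p - 7) div 6) choose ((p - 5) div 6))))
        (of_nat p ^ 2))"
proof -
  interpret prime_localization p using assms(1) by unfold_locales
  have mod: "\<exists>n. p = m * n + r" if "[p = r] (mod m)" "r < m" for m r
  proof
    have "p mod m = r" using that by (simp add: cong_def)
    then show "p = m * (p div m) + r" using mult_div_mod_eq[of m p] by simp
  qed
  show ?thesis
  proof (intro conjI impI)
    assume "[p = 1] (mod 3)"
    then obtain n where n: "p = 3 * n + 1" using mod[of 1 3] by auto
    then have "2 * (p - 1) div 3 = 2 * n" "(p - 1) div 3 = n" by simp_all
    then show "cong_loc p
        (\<Sum>k = 0..p - 1. of_nat ((2*k) choose k) * of_nat ((3*k) choose k) / (27 ^ k * (3 * of_nat k + 2)))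
        (1 / (2 * of_nat ((2 * (p - 1) div 3) choose ((p - 1) div 3))))
        (of_nat p ^ 2)" using sum_mod_3_eq_1[OF assms(2) n] unfolding cg_def by (simp only:)
  next
    assume "[p = 2] (mod 3)"
    then obtain n where n: "p = 3 * n + 2" using mod[of 2 3] by auto
    then have "2 * (p - 2) div 3 = 2 * n" "(p - 2) div 3 = n" by simp_all
    then show "cong_loc p
        (\<Sum>k = 0..p - 1. of_nat ((2*k) choose k) * of_nat ((3*k) choose k) / (27 ^ k * (3 * of_nat k + 1)))
        ((1 + 2 * of_nat p) / (2 * of_nat ((2 * (p - 2) div 3) choose ((p - 2) div 3))))
        (of_nat p ^ 2)" using sum_mod_3_eq_2[OF assms(2) n] unfolding cg_def by (simp only:)
  next
    assume "[p = 1] (mod 4)"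
    then obtain n where n: "p = 4 * n + 1" using mod[of 1 4] by auto
    then have "(p - 1) div 2 = 2 * n" "(p - 1) div 4 = n" by simp_all
    then show "cong_loc p
        (\<Sum>k = 0..p - 1. of_nat ((2*k) choose k) * of_nat ((4*k) choose (2*k)) / (64 ^ k * (4 * of_nat k + 3)))
        ((- 1) ^ ((p - 1) div 4) * ((2 ^ (p - 1) + 1) / (6 * of_nat (((p - 1) div 2) choose ((p - 1) div 4)))))
        (of_nat p ^ 2)" using sum_mod_4_eq_1[OF assms(2) n] unfolding cg_def by (simp only:)
  next
    assume "[p = 3] (mod 4)"
    then obtain n where n: "p = 4 * n + 3" using mod[of 3 4] by auto
    then have "(p - 3) div 2 = 2 * n" "(p - 3) div 4 = n" "(p + 1) div 4 = n + 1" by simp_all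
    then show "cong_loc p
        (\<Sum>k = 0..p - 1. of_nat ((2*k) choose k) * of_nat ((4*k) choose (2*k)) / (64 ^ k * (4 * of_nat k + 1)))
        ((- 1) ^ ((p + 1) div 4) *
          ((2 ^ (p - 1) + 2 * of_nat p + 1) / (6 * of_nat (((p - 3) div 2) choose ((p - 3) div 4)))))
        (of_nat p ^ 2)" using sum_mod_4_eq_3[OF assms(2) n] unfolding cg_def by (simp only:)
  next
    assume "[p = 1] (mod 6)"
    then obtain n where n: "p = 6 * n + 1" using mod[of 1 6] by auto
    then have "5 * (p - 1) div 6 = 5 * n" "(p - 1) div 6 = n" by simp_all
    then show "cong_loc p
        (\<Sum>k = 0..p - 1. of_nat ((3*k) choose k) * of_nat ((6*k) choose (3*k)) / (432 ^ k * (6 * of_nat k + 5)))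
        ((1 - 4 / 3 * (2 ^ (p - 1) - 1)) / (5 * of_nat ((5 * (p - 1) div 6) choose ((p - 1) div 6))))
        (of_nat p ^ 2)" using sum_mod_6_eq_1[OF assms(2) n] unfolding cg_def by (simp only:)
  next
    assume *: "[p = 5] (mod 6) \<and> p \<noteq> 5"
    then obtain n where n: "p = 6 * n + 5" using mod[of 5 6] by auto
    \<comment> \<open>The value \<open>n = 0\<close> would mean \<open>p = 5\<close>, excluded by
      assumption; there the right-hand side is \<open>24 / 5\<close>, outside the ring.\<close>
    have "p > 5" using * n by (cases n) auto
    have "(5 * p - 7) div 6 = 5 * n + 3" "(p - 5) div 6 = n" using n by simp_all
    then show "cong_loc p
        (\<Sum>k = 0..p - 1. of_nat ((3*k) choose k) * of_nat ((6*k) choose (3*k)) / (432 ^ k * (6 * of_nat k + 1)))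
        (4 / 5 * ((1 + 5 * of_nat p - 4 / 3 * (2 ^ (p - 1) - 1)) /
          of_nat (((5 * p - 7) div 6) choose ((p - 5) div 6))))
        (of_nat p ^ 2)" using sum_mod_6_eq_5[OF \<open>p > 5\<close> n] unfolding cg_def by (simp only:)
  qed
qed

end
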